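(* Let $\alpha,\beta\in\,]0,1[$ and $M>0$ be fixed. For all integers $n\ge2$, $d\ge1$, the test $\Psi_{2,\alpha}$ defined in the context is of level $\alpha$. Moreover, there exists a positive constant $C(\alpha,\beta,M)$ depending only on $\alpha$, $\beta$ and $M$ (not on $n$ or $d$) such that, for all $d\ge 1$, all $n\ge3$ and all $\rho>0$ such that $$\rho\ \ge\ C(\alpha,\beta,M)\,\frac{d^{1/4}}{\sqrt n}\sqrt{\ln\ln n},$$ one has $$\mathbb{P}_{f_{(\varepsilon,\mu)}}(\Psi_{2,\alpha}=0)\le\beta$$ for every $f_{(\varepsilon,\mu)}\in\mathcal F_2[M]$ such that $\varepsilon\|\mu\|\ge\rho$ and $n\varepsilon\ge C(\alpha,\beta,M)$.
   Context: Let $\phi_d$ be the density of the standard Gaussian distribution $\mathcal N_d(0_d,I_d)$ on $\mathbb{R}^d$. For $\varepsilon\in\,]0,1[$ and $\mu\in\mathbb{R}^d$ put $f_{(\varepsilon,\mu)}(x)=(1-\varepsilon)\phi_d(x)+\varepsilon\phi_d(x-\mu)$. Let $\|\cdot\|$ and $\langle\cdot,\cdot\rangle$ be the Euclidean norm and inner product, and $\mathcal F_2[M]=\{f_{(\varepsilon,\mu)}:\varepsilon\in\,]0,1[,\ \|\mu\|\le M\}$. The observed i.i.d. sample of $\mathbb{R}^d$-valued vectors is split into two parts of equal size, and $n$ denotes the size of each part: $(A_1,\dots,A_n)$ and $(Y_1,\dots,Y_n)$, all $2n$ vectors being i.i.d. For a density $g$ on $\mathbb{R}^d$, $\mathbb{P}_g$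 is the probability when the common density of these vectors is $g$; $\mathbb{P}_0:=\mathbb{P}_{\phi_d}$. A test $\Psi$ (a measurable $\{0,1\}$-valued function of the sample) has level $\alpha$ if $\mathbb{P}_0(\Psi=1)\le\alpha$. Definition of $\Psi_{2,\alpha}$. Let $\bar A_n=\frac1n\sum_{i=1}^nA_i$, $v_n=\bar A_n/\|\bar A_n\|$ (almost surely well defined), and $Z_i^{(v_n)}=\langle Y_i,v_n\rangle$ for $1\le i\le n$, with order statistics $Z^{(v_n)}_{(1)}\le\dots\le Z^{(v_n)}_{(n)}$. Let $\mathcal K_n=\{2^j:\ 0\le j\le\lfloor\log_2(n/2)\rfloor\}$. Let $Z_{(1)}\le\dots\le Z_{(n)}$ be the order statistics of $n$ i.i.d. standard real Gaussian variables; for $u\in\,]0,1[$ let $q_{u,k}$ be the $(1-u)$-quantile of $Z_{(n-k+1)}$, and let $$\alpha_n=\sup\{u\in\,]0,1[:\ \mathbb{P}(\exists k\in\mathcal K_n,\ Z_{(n-k+1)}>q_{u,k})\le\alpha\}.$$ Then $$\Psi_{2,\alpha}=\sup_{k\in\mathcal K_n}\mathbf{1}_{\{Z^{(v_n)}_{(n-k+1)}>q_{\alpha_n,k}\}}.$$ *)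

theory Defs
  imports "HOL-Probability.Probability"
begin

text \<open>
  The dimension \<open>d\<close> has to be quantified inside statements, so it cannot be a type. A vector of
  \<open>\<real>\<^sup>d\<close> is a function \<open>nat \<Rightarrow> real\<close> of which only the coordinates \<open>i < d\<close> matter; the carrier
  \<open>Rd d\<close> consists of the extensional ones, so that it is the space of \<open>lborel_d d\<close>. The Euclidean
  norm is \<open>L2_set x {..<d}\<close>. All samples are indexed from \<open>0\<close>.
\<close>

definition Rd :: "nat \<Rightarrow> (nat \<Rightarrow> real) set" where
  "Rd d = {..<d} \<rightarrow>\<^sub>E UNIV"

definition lborel_d :: "nat \<Rightarrow> (nat \<Rightarrow> real) measure" where
  "lborel_d d = (\<Pi>\<^sub>M i\<in>{..<d}. lborel)"

definition norm_d :: "nat \<Rightarrow> (nat \<Rightarrow> real) \<Rightarrow> real" where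
  "norm_d d x = L2_set x {..<d}"

definition inner_d :: "nat \<Rightarrow> (nat \<Rightarrow> real) \<Rightarrow> (nat \<Rightarrow> real) \<Rightarrow> real" where
  "inner_d d x y = (\<Sum>i<d. x i * y i)"

definition gauss_density :: "nat \<Rightarrow> (nat \<Rightarrow> real) \<Rightarrow> real" where
  "gauss_density d x = (2 * pi) powr (- (real d / 2)) * exp (- ((norm_d d x)\<^sup>2 / 2))"

definition mixture_density :: "nat \<Rightarrow> real \<Rightarrow> (nat \<Rightarrow> real) \<Rightarrow> (nat \<Rightarrow> real) \<Rightarrow> real" where
  "mixture_density d \<epsilon> \<mu> x =
     (1 - \<epsilon>) * gauss_density d x + \<epsilon> * gauss_density d (\<lambda>i. x i - \<mu> i)"

text \<open>
  A sample is a pair \<open>(A, Y)\<close> with \<open>A i, Y i \<in> Rd d\<close> for \<open>i < n\<close>; under \<open>sample_law n d g\<close> these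
  \<open>2 n\<close> vectors are i.i.d. with density \<open>g\<close>.
\<close>

type_synonym sample = "(nat \<Rightarrow> nat \<Rightarrow> real) \<times> (nat \<Rightarrow> nat \<Rightarrow> real)"

definition sample_law :: "nat \<Rightarrow> nat \<Rightarrow> ((nat \<Rightarrow> real) \<Rightarrow> real) \<Rightarrow> sample measure" where
  "sample_law n d g =
     (\<Pi>\<^sub>M i\<in>{..<n}. density (lborel_d d) (\<lambda>x. ennreal (g x))) \<Otimes>\<^sub>M
     (\<Pi>\<^sub>M i\<in>{..<n}. density (lborel_d d) (\<lambda>x. ennreal (g x)))"

text \<open>
  The \<open>\<sigma>\<close>-algebra of \<open>sample_law n d g\<close> does not depend on \<open>g\<close>, hence the choice of the null
  hypothesis as the domain of a test is immaterial for measurability.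
\<close>

definition test_of_level :: "real \<Rightarrow> nat \<Rightarrow> nat \<Rightarrow> (sample \<Rightarrow> nat) \<Rightarrow> bool" where
  "test_of_level \<alpha> n d \<Psi> \<longleftrightarrow>
     \<Psi> \<in> sample_law n d (gauss_density d) \<rightarrow>\<^sub>M count_space {0, 1} \<and>
     \<P>(s in sample_law n d (gauss_density d). \<Psi> s = 1) \<le> \<alpha>"

text \<open>\<open>order_stat n z r\<close> is the \<open>r\<close>-th smallest of \<open>z 0, \<dots>, z (n - 1)\<close>, for \<open>1 \<le> r \<le> n\<close>.\<close>

definition order_stat :: "nat \<Rightarrow> (nat \<Rightarrow> real) \<Rightarrow> nat \<Rightarrow> real" where
  "order_stat n z r = sort (map z [0..<n]) ! (r - 1)"

definition gauss_sample :: "nat \<Rightarrow> (nat \<Rightarrow> real) measure" where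
  "gauss_sample n = (\<Pi>\<^sub>M i\<in>{..<n}. std_normal_distribution)"

definition quantile :: "real measure \<Rightarrow> real \<Rightarrow> real" where
  "quantile D p = Inf {t. p \<le> cdf D t}"

definition order_quantile :: "nat \<Rightarrow> real \<Rightarrow> nat \<Rightarrow> real" where
  "order_quantile n u k = quantile (distr (gauss_sample n) borel (\<lambda>z. order_stat n z (n - k + 1))) (1 - u)"

definition K_set :: "nat \<Rightarrow> nat set" where
  "K_set n = {2 ^ j | j. int j \<le> \<lfloor>log 2 (real n / 2)\<rfloor>}"

definition alpha_n :: "nat \<Rightarrow> real \<Rightarrow> real" where
  "alpha_n n \<alpha> = Sup {u \<in> {0<..<1}.
     \<P>(z in gauss_sample n. \<exists>k\<in>K_set n. order_stat n z (n - k + 1) > order_quantile n u k) \<le> \<alpha>}"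

definition sample_mean :: "nat \<Rightarrow> (nat \<Rightarrow> nat \<Rightarrow> real) \<Rightarrow> nat \<Rightarrow> real" where
  "sample_mean n A = (\<lambda>j. (\<Sum>i<n. A i j) / real n)"

text \<open>On the null event that the sample mean vanishes, \<open>direction\<close> is the zero vector.\<close>

definition direction :: "nat \<Rightarrow> nat \<Rightarrow> (nat \<Rightarrow> nat \<Rightarrow> real) \<Rightarrow> nat \<Rightarrow> real" where
  "direction n d A = (\<lambda>j. sample_mean n A j / norm_d d (sample_mean n A))"

definition projected :: "nat \<Rightarrow> nat \<Rightarrow> sample \<Rightarrow> nat \<Rightarrow> real" where
  "projected n d s = (\<lambda>i. inner_d d (snd s i) (direction n d (fst s)))"

definition Psi2 :: "real \<Rightarrow> nat \<Rightarrow> nat \<Rightarrow> sample \<Rightarrow> nat" where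
  "Psi2 \<alpha> n d s =
     (SUP k\<in>K_set n. of_bool (order_stat n (projected n d s) (n - k + 1) > order_quantile n (alpha_n n \<alpha>) k))"

end

theory Submission
  imports Defs "HOL-Real_Asymp.Real_Asymp"
begin

text \<open>
  The two halves of the sample are independent, so everything may be done conditionally on the
  first half, that is for a fixed unit direction \<open>v\<close>.

  \<^emph>\<open>Level.\<close> If the \<open>Y\<^sub>i\<close> are standard Gaussian then so are their projections on \<open>v\<close>, whatever \<open>v\<close> is,
  and the conditional rejection probability is exactly the one that calibrates \<open>alpha_n\<close>. Two things
  remain: the sample mean is almost surely nonzero (\<open>prob_sample_mean_zero\<close>), and the supremum that
  defines \<open>alpha_n\<close> is attained (\<open>null_rejection_alpha_n_le\<close>), which uses that the distribution
  functions of Gaussian order statistics are continuous and strictly increasing. A union bound over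
  the at most \<open>log\<^sub>2 n\<close> indices gives \<open>alpha_n \<ge> \<alpha> / log\<^sub>2 n\<close>; this is where \<open>ln (ln n)\<close> comes from.

  \<^emph>\<open>Power, the direction.\<close> Write \<open>m\<close> for the norm of \<open>\<mu>\<close>. The scalar product of the sample mean with
  \<open>\<mu>\<close> has mean \<open>\<epsilon> m\<^sup>2\<close> and the squared norm of the sample mean has mean at most
  \<open>d / n + 2 (\<epsilon> m)\<^sup>2\<close>. Chebyshev's inequality for the former and Markov's for the latter show that,
  with large probability, the component of \<open>\<mu>\<close> along the estimated direction is at least a constant
  times \<open>\<epsilon> m\<^sup>2 / sqrt (d / n + (\<epsilon> m)\<^sup>2)\<close> (\<open>direction_correlated\<close>).

  \<^emph>\<open>Power, the projected sample.\<close> The projections form an i.i.d. sample from a mixture of \<open>N(0, 1)\<close> and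
  \<open>N(a, 1)\<close> with \<open>0 < a \<le> M\<close>. As the shift is bounded, one index \<open>k\<close> between \<open>n / 4\<close> and
  \<open>n / 2\<close> suffices. An order statistic exceeds \<open>t\<close> iff enough observations do, so Hoeffding's
  inequality controls both sides: under the null hypothesis it bounds the quantile by a \<open>t\<close> such
  that the expected number of exceedances of \<open>t\<close> is \<open>k\<close> minus a term of order
  \<open>sqrt (n ln (ln n))\<close> (\<open>order_quantile_le_of_tail\<close>); under the alternative this expected number is
  larger by \<open>n \<epsilon> a\<close> times a lower bound for the Gaussian density near \<open>t\<close>
  (\<open>Psi2_conditional_type_II\<close>). Since \<open>t\<close> stays in a compact set, the test detects as soon as
  \<open>\<epsilon> a\<close> is a large multiple of \<open>sqrt (ln (ln n) / n)\<close>, and the separation condition guarantees this,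
  both when the noise \<open>d / n\<close> and when the signal \<open>(\<epsilon> m)\<^sup>2\<close> dominates the norm of the sample mean
  (\<open>signal_bound\<close>).
\<close>

section \<open>Gaussian product laws and their mixtures\<close>

text \<open>
  Both sides agree on boxes: the indicator of a box is a product, so the integral of the product
  density over the box factorises by Tonelli.
\<close>

lemma density_PiM:
  assumes "product_sigma_finite M" and "product_sigma_finite (\<lambda>i. density (M i) (f i))"
    and fin: "finite I" and f [measurable]: "\<And>i. f i \<in> borel_measurable (M i)"
  shows "density (PiM I M) (\<lambda>x. \<Prod>i\<in>I. f i (x i)) = PiM I (\<lambda>i. density (M i) (f i))"
proof -
  interpret M: product_sigma_finite M by fact
  interpret D: product_sigma_finite "\<lambda>i. density (M i) (f i)" by fact
  show ?thesis
  proof (rule D.PiM_eqI[OF fin])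
    show "sets (density (PiM I M) (\<lambda>x. \<Prod>i\<in>I. f i (x i))) = sets (PiM I (\<lambda>i. density (M i) (f i)))"
      by (simp cong: sets_PiM_cong)
    fix A assume "\<And>i. i \<in> I \<Longrightarrow> A i \<in> sets (density (M i) (f i))"
    then have A [measurable]: "\<And>i. i \<in> I \<Longrightarrow> A i \<in> sets (M i)" by simp
    have PA [measurable]: "Pi\<^sub>E I A \<in> sets (PiM I M)"
      by (rule sets_PiM_I_finite[OF fin]) (use A in auto)
    have "emeasure (density (PiM I M) (\<lambda>x. \<Prod>i\<in>I. f i (x i))) (Pi\<^sub>E I A) =
        (\<integral>\<^sup>+x. (\<Prod>i\<in>I. f i (x i)) * indicator (Pi\<^sub>E I A) x \<partial>PiM I M)"
      by (rule emeasure_density) (measurable, use fin in auto)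
    also have "\<dots> = (\<integral>\<^sup>+x. (\<Prod>i\<in>I. f i (x i) * indicator (A i) (x i)) \<partial>PiM I M)"
    proof (rule nn_integral_cong)
      fix x assume x: "x \<in> space (PiM I M)"
      have "indicator (Pi\<^sub>E I A) x = (\<Prod>i\<in>I. indicator (A i) (x i) :: ennreal)"
      proof (cases "x \<in> Pi\<^sub>E I A")
        case True
        then show ?thesis by (auto intro!: prod.neutral[symmetric] simp: PiE_iff)
      next
        case False
        with x obtain i where "i \<in> I" "x i \<notin> A i" by (auto simp: PiE_iff space_PiM)
        then have "(\<Prod>i\<in>I. indicator (A i) (x i) :: ennreal) = 0"
          by (intro prod_zero[OF fin] bexI[of _ i]) auto
        with False show ?thesis by simp
      qed
      then show "(\<Prod>i\<in>I. f i (x i)) * indicator (Pi\<^sub>E I A) x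
          = (\<Prod>i\<in>I. f i (x i) * indicator (A i) (x i))"
        by (simp add: prod.distrib)
    qed
    also have "\<dots> = (\<Prod>i\<in>I. \<integral>\<^sup>+y. f i y * indicator (A i) y \<partial>M i)"
      by (rule M.product_nn_integral_prod[OF fin]) measurable
    also have "\<dots> = (\<Prod>i\<in>I. emeasure (density (M i) (f i)) (A i))"
      by (intro prod.cong refl emeasure_density[symmetric]) auto
    finally show "emeasure (density (PiM I M) (\<lambda>x. \<Prod>i\<in>I. f i (x i))) (Pi\<^sub>E I A) =
        (\<Prod>i\<in>I. emeasure (density (M i) (f i)) (A i))" .
  qed
qed

text \<open>
  Independence of a family means that its joint law is the product of the marginal laws; for the
  coordinates of a product measure the joint law is the measure itself.
\<close>

lemma indep_vars_PiM_coordinates: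
  assumes "\<And>i. i \<in> I \<Longrightarrow> prob_space (M i)" "I \<noteq> {}"
  shows "prob_space.indep_vars (PiM I M) M (\<lambda>i x. x i) I"
proof -
  interpret prob_space "PiM I M" by (rule prob_space_PiM) fact
  have "distr (PiM I M) (PiM I M) (\<lambda>x. \<lambda>i\<in>I. x i) = distr (PiM I M) (PiM I M) (\<lambda>x. x)"
    by (rule distr_cong) (auto simp: space_PiM)
  also have "\<dots> = PiM I M" by simp
  also have "\<dots> = (\<Pi>\<^sub>M i\<in>I. distr (PiM I M) (M i) (\<lambda>x. x i))"
    by (rule PiM_cong) (simp_all add: distr_PiM_component assms(1))
  finally show ?thesis
    by (subst indep_vars_iff_distr_eq_PiM'[OF \<open>I \<noteq> {}\<close>]) simp_all
qed

definition gauss_law :: "nat \<Rightarrow> (nat \<Rightarrow> real) \<Rightarrow> (nat \<Rightarrow> real) measure" where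
  "gauss_law d \<mu> = (\<Pi>\<^sub>M i\<in>{..<d}. density lborel (normal_density (\<mu> i) 1))"

lemma prob_space_gauss_law: "prob_space (gauss_law d \<mu>)"
  unfolding gauss_law_def by (intro prob_space_PiM prob_space_normal_density) simp

lemma gauss_sample_eq_gauss_law: "gauss_sample n = gauss_law n (\<lambda>_. 0)"
  by (simp add: gauss_sample_def gauss_law_def)

lemma sets_lborel_d [measurable_cong]: "sets (lborel_d d) = sets (PiM {..<d} (\<lambda>_. borel))"
  unfolding lborel_d_def by (rule sets_PiM_cong) auto

lemma sets_gauss_law [measurable_cong]: "sets (gauss_law d \<mu>) = sets (PiM {..<d} (\<lambda>_. borel))"
  unfolding gauss_law_def by (rule sets_PiM_cong) auto

lemma inner_d_measurable [measurable]:
  "(\<lambda>x. inner_d d x w) \<in> borel_measurable (PiM {..<d} (\<lambda>_. borel))"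
  unfolding inner_d_def by measurable

lemma norm_d_power2: "(norm_d d x)\<^sup>2 = (\<Sum>i<d. (x i)\<^sup>2)"
  by (simp add: norm_d_def L2_set_def sum_nonneg)

lemma inner_d_self: "inner_d d x x = (norm_d d x)\<^sup>2"
  by (simp add: inner_d_def norm_d_power2) (simp add: power2_eq_square)

lemma norm_d_nonneg [simp]: "norm_d d x \<ge> 0"
  by (simp add: norm_d_def)

definition unit_vec :: "nat \<Rightarrow> nat \<Rightarrow> real" where
  "unit_vec j = (\<lambda>i. if i = j then 1 else 0)"

lemma inner_d_unit_vec: "j < d \<Longrightarrow> inner_d d x (unit_vec j) = x j"
  unfolding inner_d_def unit_vec_def by (subst sum.remove[of _ j]) auto

lemma norm_d_unit_vec:
  assumes "j < d"
  shows "norm_d d (unit_vec j) = 1"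
proof -
  have "(norm_d d (unit_vec j))\<^sup>2 = unit_vec j j"
    using inner_d_unit_vec[OF assms, of "unit_vec j"] by (simp only: inner_d_self)
  then have "(norm_d d (unit_vec j))\<^sup>2 = 1\<^sup>2" by (simp add: unit_vec_def)
  then show ?thesis by (rule power2_eq_imp_eq) simp_all
qed

lemma gauss_density_nonneg: "gauss_density d x \<ge> 0"
  by (simp add: gauss_density_def)

text \<open>
  The squared norm is a sum over the coordinates, so the \<open>d\<close>-dimensional density is the product of
  its marginals. This is the bridge from densities on \<open>\<real>\<^sup>d\<close> to independent Gaussian coordinates.
\<close>

lemma gauss_density_shift_eq_prod:
  "gauss_density d (\<lambda>i. x i - \<mu> i) = (\<Prod>i<d. normal_density (\<mu> i) 1 (x i))"
proof -
  have "(2 * pi) powr (- (real d / 2)) = (1 / sqrt (2 * pi)) ^ d"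
  proof -
    have pi: "0 < 2 * pi" and spi: "0 < sqrt (2 * pi)" by simp_all
    have "(2 * pi) powr (- (real d / 2)) = ((2 * pi) powr (1 / 2)) powr (- real d)"
      by (simp add: powr_powr)
    also have "\<dots> = 1 / sqrt (2 * pi) ^ d"
      by (simp only: powr_half_sqrt[OF less_imp_le[OF pi]] powr_minus powr_realpow[OF spi] inverse_eq_divide)
    finally show ?thesis by (simp add: power_divide)
  qed
  moreover have "exp (- ((norm_d d (\<lambda>i. x i - \<mu> i))\<^sup>2 / 2)) = (\<Prod>i<d. exp (- (x i - \<mu> i)\<^sup>2 / 2))"
    by (simp add: norm_d_power2 exp_sum[symmetric] sum_negf sum_divide_distrib)
  ultimately show ?thesis
    by (simp add: gauss_density_def normal_density_def prod_dividef power_divide)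
qed

lemma gauss_density_shift_measurable [measurable]:
  "(\<lambda>x. gauss_density d (\<lambda>i. x i - \<mu> i)) \<in> borel_measurable (PiM {..<d} (\<lambda>_. borel))"
  unfolding gauss_density_shift_eq_prod by measurable

lemma gauss_density_measurable [measurable]:
  "gauss_density d \<in> borel_measurable (PiM {..<d} (\<lambda>_. borel))"
  using gauss_density_shift_measurable[of d "\<lambda>_. 0"] by simp

lemma density_gauss_density_shift:
  "density (lborel_d d) (\<lambda>x. gauss_density d (\<lambda>i. x i - \<mu> i)) = gauss_law d \<mu>"
proof -
  have "product_sigma_finite (\<lambda>i. density lborel (\<lambda>x. ennreal (normal_density (\<mu> i) 1 x)))"
    by (intro product_sigma_finite.intro prob_space_imp_sigma_finite prob_space_normal_density) simp
  moreover have "product_sigma_finite (\<lambda>i::nat. lborel :: real measure)"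
    by (intro product_sigma_finite.intro lborel.sigma_finite_measure_axioms)
  ultimately have "density (PiM {..<d} (\<lambda>_. lborel)) (\<lambda>x. \<Prod>i<d. ennreal (normal_density (\<mu> i) 1 (x i))) = gauss_law d \<mu>"
    unfolding gauss_law_def by (intro density_PiM) auto
  then show ?thesis
    by (simp add: lborel_d_def gauss_density_shift_eq_prod prod_ennreal)
qed

lemma density_gauss_density: "density (lborel_d d) (\<lambda>x. gauss_density d x) = gauss_law d (\<lambda>_. 0)"
  using density_gauss_density_shift[of d "\<lambda>_. 0"] by simp

text \<open>
  A linear combination of independent Gaussian variables is Gaussian. Every fact about the projected
  sample rests on this lemma: the image depends on the mean only through its component along \<open>w\<close>.
\<close>

lemma distributed_inner_d_gauss_law:
  assumes w: "norm_d d w \<noteq> 0"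
  shows "distributed (gauss_law d \<mu>) lborel (\<lambda>x. inner_d d x w)
           (normal_density (inner_d d \<mu> w) (norm_d d w))"
proof -
  interpret prob_space "gauss_law d \<mu>" by (rule prob_space_gauss_law)
  \<comment> \<open>Coordinates with weight 0 would contribute a degenerate Gaussian, which has no density; they are
    dropped from the sum.\<close>
  define J where "J = {i\<in>{..<d}. w i \<noteq> 0}"
  have J: "finite J" "J \<subseteq> {..<d}" by (auto simp: J_def)
  have "J \<noteq> {}"
  proof
    assume "J = {}"
    then have "(norm_d d w)\<^sup>2 = 0" by (auto simp: norm_d_power2 J_def)
    with w show False by simp
  qed
  then have "{..<d} \<noteq> {}" using J by auto
  have N: "prob_space (density lborel (normal_density (\<mu> i) 1))" for i
    by (rule prob_space_normal_density) simp
  have "indep_vars (\<lambda>i. density lborel (normal_density (\<mu> i) 1)) (\<lambda>i x. x i) {..<d}"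
    using indep_vars_PiM_coordinates[OF N \<open>{..<d} \<noteq> {}\<close>] unfolding gauss_law_def .
  then have "indep_vars (\<lambda>i. density lborel (normal_density (\<mu> i) 1)) (\<lambda>i x. x i) J"
    by (rule indep_vars_subset) fact
  then have indep: "indep_vars (\<lambda>_. borel) (\<lambda>i x. 0 + w i * x i) J"
    by (rule indep_vars_compose2) auto
  have "distributed (gauss_law d \<mu>) lborel (\<lambda>x. 0 + w i * x i)
      (normal_density (0 + w i * \<mu> i) (\<bar>w i\<bar> * 1))" if "i \<in> J" for i
  proof (rule normal_density_affine)
    have "distr (gauss_law d \<mu>) lborel (\<lambda>x. x i)
        = distr (gauss_law d \<mu>) (density lborel (normal_density (\<mu> i) 1)) (\<lambda>x. x i)"
      by (rule distr_cong) auto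
    also have "\<dots> = density lborel (normal_density (\<mu> i) 1)"
      unfolding gauss_law_def using N that J by (intro distr_PiM_component) auto
    finally show "distributed (gauss_law d \<mu>) lborel (\<lambda>x. x i) (normal_density (\<mu> i) 1)"
      using that J unfolding distributed_def by (auto intro!: measurable_component_singleton)
  qed (use that in \<open>auto simp: J_def\<close>)
  then have "distributed (gauss_law d \<mu>) lborel (\<lambda>x. \<Sum>i\<in>J. 0 + w i * x i)
      (normal_density (\<Sum>i\<in>J. 0 + w i * \<mu> i) (sqrt (\<Sum>i\<in>J. (\<bar>w i\<bar> * 1)\<^sup>2)))"
    using J \<open>J \<noteq> {}\<close> by (intro sum_indep_normal indep) (auto simp: J_def)
  moreover have "(\<Sum>i\<in>J. 0 + w i * x i) = inner_d d x w" for x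
    unfolding inner_d_def J_def by (intro sum.mono_neutral_cong_left) auto
  moreover have "sqrt (\<Sum>i\<in>J. (\<bar>w i\<bar> * 1)\<^sup>2) = norm_d d w"
    unfolding norm_d_def L2_set_def J_def
    by (intro arg_cong[where f=sqrt] sum.mono_neutral_cong_left) auto
  ultimately show ?thesis by simp
qed

definition mixture_law :: "nat \<Rightarrow> real \<Rightarrow> (nat \<Rightarrow> real) \<Rightarrow> (nat \<Rightarrow> real) measure" where
  "mixture_law d \<epsilon> \<mu> = density (lborel_d d) (\<lambda>x. ennreal (mixture_density d \<epsilon> \<mu> x))"

lemma sets_mixture_law [measurable_cong]:
  "sets (mixture_law d \<epsilon> \<mu>) = sets (PiM {..<d} (\<lambda>_. borel))"
  by (simp add: mixture_law_def sets_lborel_d)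

text \<open>
  The mixture is a convex combination of two Gaussian laws. Probabilities and expectations under it
  are computed on the two components, so that no latent label has to be introduced.
\<close>

lemma emeasure_mixture_law:
  assumes "0 \<le> \<epsilon>" "\<epsilon> \<le> 1" and B [measurable]: "B \<in> sets (PiM {..<d} (\<lambda>_. borel))"
  shows "emeasure (mixture_law d \<epsilon> \<mu>) B
    = ennreal (1 - \<epsilon>) * emeasure (gauss_law d (\<lambda>_. 0)) B + ennreal \<epsilon> * emeasure (gauss_law d \<mu>) B"
proof -
  have "emeasure (mixture_law d \<epsilon> \<mu>) B
      = (\<integral>\<^sup>+x. ennreal (1 - \<epsilon>) * (ennreal (gauss_density d x) * indicator B x)
           + ennreal \<epsilon> * (ennreal (gauss_density d (\<lambda>i. x i - \<mu> i)) * indicator B x) \<partial>lborel_d d)"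
    unfolding mixture_law_def mixture_density_def using assms(1,2)
    by (subst emeasure_density)
       (auto intro!: nn_integral_cong
             simp: ennreal_plus ennreal_mult gauss_density_nonneg distrib_right mult.assoc)
  also have "\<dots> = ennreal (1 - \<epsilon>) * (\<integral>\<^sup>+x. ennreal (gauss_density d x) * indicator B x \<partial>lborel_d d)
      + ennreal \<epsilon> * (\<integral>\<^sup>+x. ennreal (gauss_density d (\<lambda>i. x i - \<mu> i)) * indicator B x \<partial>lborel_d d)"
    by (subst nn_integral_add) (auto simp: nn_integral_cmult)
  also have "\<dots> = ennreal (1 - \<epsilon>) * emeasure (gauss_law d (\<lambda>_. 0)) B + ennreal \<epsilon> * emeasure (gauss_law d \<mu>) B"
    by (simp add: emeasure_density density_gauss_density_shift[symmetric]
        density_gauss_density[symmetric])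
  finally show ?thesis .
qed

lemma prob_space_mixture_law:
  assumes "0 \<le> \<epsilon>" "\<epsilon> \<le> 1"
  shows "prob_space (mixture_law d \<epsilon> \<mu>)"
proof
  have sp: "space (mixture_law d \<epsilon> \<mu>) = space (PiM {..<d} (\<lambda>_. borel))"
    "space (gauss_law d \<nu>) = space (PiM {..<d} (\<lambda>_. borel))" for \<nu>
    by (rule sets_eq_imp_space_eq, rule sets_mixture_law sets_gauss_law)+
  have "emeasure (gauss_law d \<nu>) (space (PiM {..<d} (\<lambda>_. borel))) = 1" for \<nu>
    using prob_space.emeasure_space_1[OF prob_space_gauss_law[of d \<nu>]] sp(2) by simp
  then have "emeasure (mixture_law d \<epsilon> \<mu>) (space (PiM {..<d} (\<lambda>_. borel))) = ennreal (1 - \<epsilon>) + ennreal \<epsilon>"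
    by (subst emeasure_mixture_law[OF assms]) auto
  also have "\<dots> = 1" using assms by (simp flip: ennreal_plus)
  finally show "emeasure (mixture_law d \<epsilon> \<mu>) (space (mixture_law d \<epsilon> \<mu>)) = 1" unfolding sp .
qed

lemma measure_mixture_law:
  assumes "0 \<le> \<epsilon>" "\<epsilon> \<le> 1" and B: "B \<in> sets (PiM {..<d} (\<lambda>_. borel))"
  shows "measure (mixture_law d \<epsilon> \<mu>) B
    = (1 - \<epsilon>) * measure (gauss_law d (\<lambda>_. 0)) B + \<epsilon> * measure (gauss_law d \<mu>) B"
proof -
  interpret G0: prob_space "gauss_law d (\<lambda>_. 0)" by (rule prob_space_gauss_law)
  interpret G: prob_space "gauss_law d \<mu>" by (rule prob_space_gauss_law)
  interpret m: prob_space "mixture_law d \<epsilon> \<mu>" by (rule prob_space_mixture_law[OF assms(1,2)])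
  have "ennreal (measure (mixture_law d \<epsilon> \<mu>) B) = ennreal ((1 - \<epsilon>) * measure (gauss_law d (\<lambda>_. 0)) B + \<epsilon> * measure (gauss_law d \<mu>) B)"
    using emeasure_mixture_law[OF assms, of \<mu>] assms(1,2)
    by (simp add: G0.emeasure_eq_measure G.emeasure_eq_measure m.emeasure_eq_measure ennreal_plus ennreal_mult)
  then show ?thesis using assms(1,2) by (subst (asm) ennreal_inj) auto
qed

lemma
  assumes "0 \<le> \<epsilon>" "\<epsilon> \<le> 1"
    and g: "integrable (gauss_law d (\<lambda>_. 0)) g" "integrable (gauss_law d \<mu>) g"
  shows integrable_mixture_law: "integrable (mixture_law d \<epsilon> \<mu>) g"
    and integral_mixture_law: "integral\<^sup>L (mixture_law d \<epsilon> \<mu>) g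
      = (1 - \<epsilon>) * integral\<^sup>L (gauss_law d (\<lambda>_. 0)) g + \<epsilon> * (integral\<^sup>L (gauss_law d \<mu>) g :: real)"
proof -
  have [measurable]: "g \<in> borel_measurable (PiM {..<d} (\<lambda>_. borel))"
    using borel_measurable_integrable[OF g(1)] by measurable
  note dens = density_gauss_density_shift[symmetric, of d \<mu>] density_gauss_density[symmetric]
  have i0: "integrable (lborel_d d) (\<lambda>x. gauss_density d x * g x)"
    using g(1) unfolding dens by (subst (asm) integrable_real_density) (auto simp: gauss_density_nonneg)
  have i1: "integrable (lborel_d d) (\<lambda>x. gauss_density d (\<lambda>i. x i - \<mu> i) * g x)"
    using g(2) unfolding dens by (subst (asm) integrable_real_density) (auto simp: gauss_density_nonneg)
  have eq: "mixture_density d \<epsilon> \<mu> x * g x = (1 - \<epsilon>) * (gauss_density d x * g x)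
      + \<epsilon> * (gauss_density d (\<lambda>i. x i - \<mu> i) * g x)" for x
    by (simp add: mixture_density_def algebra_simps)
  have [measurable]: "mixture_density d \<epsilon> \<mu> \<in> borel_measurable (PiM {..<d} (\<lambda>_. borel))"
    unfolding mixture_density_def by measurable
  have nonneg: "mixture_density d \<epsilon> \<mu> x \<ge> 0" for x
    using assms(1,2) by (simp add: mixture_density_def gauss_density_nonneg)
  show "integrable (mixture_law d \<epsilon> \<mu>) g"
    unfolding mixture_law_def
    by (subst integrable_real_density) (use i0 i1 in \<open>auto simp: nonneg eq\<close>)
  show "integral\<^sup>L (mixture_law d \<epsilon> \<mu>) g
      = (1 - \<epsilon>) * integral\<^sup>L (gauss_law d (\<lambda>_. 0)) g + \<epsilon> * integral\<^sup>L (gauss_law d \<mu>) g"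
    unfolding mixture_law_def dens
    by (simp add: integral_real_density nonneg gauss_density_nonneg eq i0 i1)
qed

lemma
  assumes w: "norm_d d w \<noteq> 0"
  shows integrable_inner_d_gauss_law: "integrable (gauss_law d \<mu>) (\<lambda>x. inner_d d x w)"
    and integrable_inner_d_power2_gauss_law: "integrable (gauss_law d \<mu>) (\<lambda>x. (inner_d d x w)\<^sup>2)"
    and expectation_inner_d_gauss_law: "(\<integral>x. inner_d d x w \<partial>gauss_law d \<mu>) = inner_d d \<mu> w"
    and expectation_inner_d_power2_gauss_law:
      "(\<integral>x. (inner_d d x w)\<^sup>2 \<partial>gauss_law d \<mu>) = (norm_d d w)\<^sup>2 + (inner_d d \<mu> w)\<^sup>2"
proof -
  interpret prob_space "gauss_law d \<mu>" by (rule prob_space_gauss_law)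
  note D = distributed_inner_d_gauss_law[OF w, of \<mu>]
  have pos: "0 < norm_d d w" using w norm_d_nonneg[of d w] by linarith
  show i1: "integrable (gauss_law d \<mu>) (\<lambda>x. inner_d d x w)"
    using distributed_integrable[OF D, of "\<lambda>x. x"] integrable_normal_moment_nz_1[OF pos] by simp
  show e1: "(\<integral>x. inner_d d x w \<partial>gauss_law d \<mu>) = inner_d d \<mu> w"
    by (rule normal_distributed_expectation[OF pos D])
  have "integrable (gauss_law d \<mu>) (\<lambda>x. (inner_d d x w - inner_d d \<mu> w)\<^sup>2)"
    using distributed_integrable[OF D, of "\<lambda>x. (x - inner_d d \<mu> w)\<^sup>2"]
      integrable_normal_moment[OF pos, of _ 2] by simp
  then have "integrable (gauss_law d \<mu>) (\<lambda>x. (inner_d d x w - inner_d d \<mu> w)\<^sup>2 +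
      (2 * inner_d d \<mu> w * inner_d d x w - (inner_d d \<mu> w)\<^sup>2))"
    using i1 by (intro Bochner_Integration.integrable_add Bochner_Integration.integrable_diff) auto
  also have "(\<lambda>x. (inner_d d x w - inner_d d \<mu> w)\<^sup>2 +
      (2 * inner_d d \<mu> w * inner_d d x w - (inner_d d \<mu> w)\<^sup>2)) = (\<lambda>x. (inner_d d x w)\<^sup>2)"
    by (simp add: power2_diff algebra_simps)
  finally show i2: "integrable (gauss_law d \<mu>) (\<lambda>x. (inner_d d x w)\<^sup>2)" .
  show "(\<integral>x. (inner_d d x w)\<^sup>2 \<partial>gauss_law d \<mu>) = (norm_d d w)\<^sup>2 + (inner_d d \<mu> w)\<^sup>2"
    using normal_distributed_variance[OF pos D] variance_eq[OF i1 i2] e1 by simp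
qed

lemma
  assumes "0 \<le> \<epsilon>" "\<epsilon> \<le> 1" and w: "norm_d d w \<noteq> 0"
  shows integrable_inner_d_mixture_law: "integrable (mixture_law d \<epsilon> \<mu>) (\<lambda>x. inner_d d x w)"
    and integrable_inner_d_power2_mixture_law: "integrable (mixture_law d \<epsilon> \<mu>) (\<lambda>x. (inner_d d x w)\<^sup>2)"
    and expectation_inner_d_mixture_law: "(\<integral>x. inner_d d x w \<partial>mixture_law d \<epsilon> \<mu>) = \<epsilon> * inner_d d \<mu> w"
    and expectation_inner_d_power2_mixture_law:
      "(\<integral>x. (inner_d d x w)\<^sup>2 \<partial>mixture_law d \<epsilon> \<mu>) = (norm_d d w)\<^sup>2 + \<epsilon> * (inner_d d \<mu> w)\<^sup>2"
proof -
  note i = integrable_inner_d_gauss_law[OF w] integrable_inner_d_power2_gauss_law[OF w]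
  have z: "inner_d d (\<lambda>_. 0) w = 0" by (simp add: inner_d_def)
  show "integrable (mixture_law d \<epsilon> \<mu>) (\<lambda>x. inner_d d x w)"
    "integrable (mixture_law d \<epsilon> \<mu>) (\<lambda>x. (inner_d d x w)\<^sup>2)"
    by (intro integrable_mixture_law assms i)+
  show "(\<integral>x. inner_d d x w \<partial>mixture_law d \<epsilon> \<mu>) = \<epsilon> * inner_d d \<mu> w"
    by (simp add: integral_mixture_law assms i expectation_inner_d_gauss_law z)
  show "(\<integral>x. (inner_d d x w)\<^sup>2 \<partial>mixture_law d \<epsilon> \<mu>) = (norm_d d w)\<^sup>2 + \<epsilon> * (inner_d d \<mu> w)\<^sup>2"
    by (simp add: integral_mixture_law assms i expectation_inner_d_power2_gauss_law z)
       (simp add: algebra_simps)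
qed

section \<open>Sums and counts over independent copies\<close>

lemma
  fixes f :: "_ \<Rightarrow> real"
  assumes M: "\<And>i. i \<in> I \<Longrightarrow> prob_space (M i)" and i: "i \<in> I" and f: "integrable (M i) f"
  shows integrable_PiM_coordinate: "integrable (PiM I M) (\<lambda>x. f (x i))"
    and integral_PiM_coordinate: "(\<integral>x. f (x i) \<partial>PiM I M) = integral\<^sup>L (M i) f"
proof -
  have D: "distr (PiM I M) (M i) (\<lambda>x. x i) = M i" using M i by (rule distr_PiM_component)
  have [measurable]: "f \<in> borel_measurable (M i)" using f by auto
  show "integrable (PiM I M) (\<lambda>x. f (x i))"
    using i by (subst integrable_distr_eq[symmetric, where N="M i" and g="\<lambda>x. x i"]) (auto simp: D f)
  show "(\<integral>x. f (x i) \<partial>PiM I M) = integral\<^sup>L (M i) f"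
    using i by (subst integral_distr[symmetric, where N="M i" and g="\<lambda>x. x i"]) (auto simp: D)
qed

text \<open>
  The square of the sum is expanded into pairs: a diagonal pair contributes the second moment, an
  off-diagonal pair, by independence, the square of the mean. The last formula is variance plus
  squared mean.
\<close>

lemma
  fixes h :: "_ \<Rightarrow> real"
  assumes P: "prob_space P" and h: "integrable P h" "integrable P (\<lambda>x. (h x)\<^sup>2)"
  shows integrable_iid_sum: "integrable (\<Pi>\<^sub>M i\<in>{..<n}. P) (\<lambda>x. \<Sum>i<n. h (x i))"
    and integrable_iid_sum_power2: "integrable (\<Pi>\<^sub>M i\<in>{..<n}. P) (\<lambda>x. (\<Sum>i<n. h (x i))\<^sup>2)"
    and expectation_iid_sum: "(\<integral>x. (\<Sum>i<n. h (x i)) \<partial>(\<Pi>\<^sub>M i\<in>{..<n}. P)) = real n * integral\<^sup>L P h"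
    and expectation_iid_sum_power2: "(\<integral>x. (\<Sum>i<n. h (x i))\<^sup>2 \<partial>(\<Pi>\<^sub>M i\<in>{..<n}. P))
      = real n * ((\<integral>x. (h x)\<^sup>2 \<partial>P) - (integral\<^sup>L P h)\<^sup>2) + (real n * integral\<^sup>L P h)\<^sup>2"
proof -
  let ?Q = "\<Pi>\<^sub>M i\<in>{..<n}. P"
  interpret Q: prob_space ?Q by (rule prob_space_PiM) (rule P)
  have [measurable]: "h \<in> borel_measurable P" using h by auto
  have i1: "integrable ?Q (\<lambda>x. h (x i))" "(\<integral>x. h (x i) \<partial>?Q) = integral\<^sup>L P h" if "i < n" for i
    using integrable_PiM_coordinate[OF P _ h(1), of i "{..<n}"] integral_PiM_coordinate[OF P _ h(1), of i "{..<n}"]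
      that by auto
  have i2: "integrable ?Q (\<lambda>x. (h (x i))\<^sup>2)" "(\<integral>x. (h (x i))\<^sup>2 \<partial>?Q) = (\<integral>x. (h x)\<^sup>2 \<partial>P)" if "i < n" for i
    using integrable_PiM_coordinate[OF P _ h(2), of i "{..<n}"] integral_PiM_coordinate[OF P _ h(2), of i "{..<n}"]
      that by auto
  have mixed: "integrable ?Q (\<lambda>x. h (x i) * h (x j)) \<and>
      (\<integral>x. h (x i) * h (x j) \<partial>?Q) = (if i = j then (\<integral>x. (h x)\<^sup>2 \<partial>P) else (integral\<^sup>L P h)\<^sup>2)"
    if ij: "i < n" "j < n" for i j
  proof (cases "i = j")
    case True
    with i2[OF ij(1)] show ?thesis by (simp add: power2_eq_square)
  next
    case False
    have "Q.indep_vars (\<lambda>_. P) (\<lambda>i x. x i) {..<n}"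
      using ij by (intro indep_vars_PiM_coordinates P) auto
    then have "Q.indep_vars (\<lambda>_. P) (\<lambda>i x. x i) {i, j}"
      by (rule Q.indep_vars_subset) (use ij in auto)
    then have iv: "Q.indep_vars (\<lambda>_. borel) (\<lambda>i x. h (x i)) {i, j}"
      by (rule Q.indep_vars_compose2) auto
    have "finite {i, j}" and int: "\<And>k. k \<in> {i, j} \<Longrightarrow> integrable ?Q (\<lambda>x. h (x k))"
      using i1 ij by auto
    then show ?thesis
      using Q.indep_vars_lebesgue_integral[OF _ iv int] Q.indep_vars_integrable[OF _ iv int] False
      by (simp add: i1 ij power2_eq_square)
  qed
  have sq: "(\<Sum>i<n. h (x i))\<^sup>2 = (\<Sum>i<n. \<Sum>j<n. h (x i) * h (x j))" for x
    by (simp add: power2_eq_square sum_product)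
  show "integrable ?Q (\<lambda>x. \<Sum>i<n. h (x i))" using i1 by auto
  show "(\<integral>x. (\<Sum>i<n. h (x i)) \<partial>?Q) = real n * integral\<^sup>L P h" using i1 by simp
  show "integrable ?Q (\<lambda>x. (\<Sum>i<n. h (x i))\<^sup>2)" 
    unfolding sq by (intro Bochner_Integration.integrable_sum) (use mixed in auto)
  have "(\<integral>x. (\<Sum>i<n. h (x i))\<^sup>2 \<partial>?Q)
      = (\<Sum>i<n. \<Sum>j<n. if i = j then (\<integral>x. (h x)\<^sup>2 \<partial>P) else (integral\<^sup>L P h)\<^sup>2)"
    unfolding sq using mixed
    by (subst Bochner_Integration.integral_sum Bochner_Integration.integrable_sum
        | auto intro!: sum.cong Bochner_Integration.integrable_sum)+
  also have "\<dots> = (\<Sum>i<n. \<Sum>j<n. (if i = j then (\<integral>x. (h x)\<^sup>2 \<partial>P) - (integral\<^sup>L P h)\<^sup>2 else 0) + (integral\<^sup>L P h)\<^sup>2)"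
    by (intro sum.cong) auto
  also have "\<dots> = real n * ((\<integral>x. (h x)\<^sup>2 \<partial>P) - (integral\<^sup>L P h)\<^sup>2) + (real n * integral\<^sup>L P h)\<^sup>2"
    by (simp add: sum.distrib power_mult_distrib) (simp add: power2_eq_square distrib_left)
  finally show "(\<integral>x. (\<Sum>i<n. h (x i))\<^sup>2 \<partial>?Q)
      = real n * ((\<integral>x. (h x)\<^sup>2 \<partial>P) - (integral\<^sup>L P h)\<^sup>2) + (real n * integral\<^sup>L P h)\<^sup>2" .
qed

lemma card_eq_sum_indicator:
  fixes n :: nat
  shows "real (card {i. i < n \<and> z i \<in> B}) = (\<Sum>i<n. indicat_real B (z i))"
proof -
  have "(\<Sum>i<n. indicat_real B (z i)) = (\<Sum>i\<in>{i. i < n \<and> z i \<in> B}. 1)"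
    by (intro sum.mono_neutral_cong_right) (auto simp: indicator_def)
  then show ?thesis by simp
qed

text \<open>
  The number of hits of \<open>B\<close> is a sum of independent indicators, to which Hoeffding's inequality
  applies. An exponential bound is essential: the null quantile is needed at a level of order
  \<open>1 / ln n\<close>, for which a variance bound would cost a power of \<open>ln n\<close> instead of \<open>ln (ln n)\<close>.
\<close>

lemma
  assumes P: "prob_space P" and B [measurable]: "B \<in> sets P" and n: "0 < n" and s: "0 \<le> s"
  shows prob_count_ge: "\<P>(x in (\<Pi>\<^sub>M i\<in>{..<n}. P). real n * measure P B + s \<le> real (card {i. i < n \<and> x i \<in> B}))
      \<le> exp (- 2 * s\<^sup>2 / real n)"
    and prob_count_le: "\<P>(x in (\<Pi>\<^sub>M i\<in>{..<n}. P). real (card {i. i < n \<and> x i \<in> B}) \<le> real n * measure P B - s)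
      \<le> exp (- 2 * s\<^sup>2 / real n)"
proof -
  let ?Q = "\<Pi>\<^sub>M i\<in>{..<n}. P"
  interpret P: prob_space P by fact
  interpret Q: prob_space ?Q by (rule prob_space_PiM) (rule P)
  have "Q.indep_vars (\<lambda>_. P) (\<lambda>i x. x i) {..<n}"
    using n by (intro indep_vars_PiM_coordinates P) auto
  then have indep: "Q.indep_vars (\<lambda>_. borel) (\<lambda>i x. indicat_real B (x i)) {..<n}"
    by (rule Q.indep_vars_compose2) auto
  have ind: "integrable P (indicat_real B)"
    by (rule P.integrable_const_bound[of _ 1]) auto
  have "(\<integral>x. indicat_real B (x i) \<partial>?Q) = integral\<^sup>L P (indicat_real B)" if "i < n" for i
    by (rule integral_PiM_coordinate) (use P that ind in auto)
  then have mean: "(\<Sum>i<n. \<integral>x. indicat_real B (x i) \<partial>?Q) = real n * measure P B"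
    by simp
  interpret Hoeffding_ineq ?Q "{..<n}" "\<lambda>i x. indicat_real B (x i)" "\<lambda>_. 0" "\<lambda>_. 1" "real n * measure P B"
  proof unfold_locales
    show "AE x in ?Q. indicat_real B (x i) \<in> {0..1}" for i
      by (rule AE_I2) (simp add: indicator_def)
    show "real n * measure P B \<equiv> \<Sum>i<n. \<integral>x. indicat_real B (x i) \<partial>?Q"
      by (rule eq_reflection) (rule mean[symmetric])
  qed (auto simp: indep)
  show "\<P>(x in ?Q. real n * measure P B + s \<le> real (card {i. i < n \<and> x i \<in> B})) \<le> exp (- 2 * s\<^sup>2 / real n)"
    using Hoeffding_ineq_ge[OF s] n by (simp add: card_eq_sum_indicator)
  show "\<P>(x in ?Q. real (card {i. i < n \<and> x i \<in> B}) \<le> real n * measure P B - s) \<le> exp (- 2 * s\<^sup>2 / real n)"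
    using Hoeffding_ineq_le[OF s] n by (simp add: card_eq_sum_indicator)
qed

section \<open>Order statistics and the grid of their indices\<close>

lemma sorted_nth_gt_iff:
  fixes xs :: "real list"
  assumes "sorted xs" "1 \<le> k" "k \<le> length xs"
  shows "t < xs ! (length xs - k) \<longleftrightarrow> k \<le> length (filter (\<lambda>x. t < x) xs)"
proof -
  let ?J = "{i. i < length xs \<and> t < xs ! i}"
  have card: "length (filter (\<lambda>x. t < x) xs) = card ?J" by (rule length_filter_conv_card)
  show ?thesis
  proof
    assume t: "t < xs ! (length xs - k)"
    have "{length xs - k..<length xs} \<subseteq> ?J"
      using sorted_nth_mono[OF assms(1), of "length xs - k"] t by force
    then have "card {length xs - k..<length xs} \<le> card ?J" by (intro card_mono) auto
    with assms show "k \<le> length (filter (\<lambda>x. t < x) xs)" unfolding card by simp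
  next
    assume k: "k \<le> length (filter (\<lambda>x. t < x) xs)"
    show "t < xs ! (length xs - k)"
    proof (rule ccontr)
      assume n: "\<not> t < xs ! (length xs - k)"
      have "?J \<subseteq> {length xs - k<..<length xs}"
      proof
        fix i assume i: "i \<in> ?J"
        have "\<not> i \<le> length xs - k"
        proof
          assume "i \<le> length xs - k"
          then have "xs ! i \<le> xs ! (length xs - k)"
            using assms by (intro sorted_nth_mono) auto
          with n i show False by auto
        qed
        with i show "i \<in> {length xs - k<..<length xs}" by auto
      qed
      then have "card ?J \<le> card {length xs - k<..<length xs}" by (intro card_mono) auto
      with k assms show False unfolding card by simp
    qed
  qed
qed

text \<open>
  This turns every event about order statistics into an event about the number of exceedances of a
  threshold; it yields measurability and opens the way to Hoeffding's inequality.
\<close>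

lemma order_stat_gt_iff:
  assumes "1 \<le> k" "k \<le> n"
  shows "t < order_stat n z (n - k + 1) \<longleftrightarrow> k \<le> card {i. i < n \<and> t < z i}"
proof -
  have "t < order_stat n z (n - k + 1) \<longleftrightarrow> k \<le> length (filter (\<lambda>x. t < x) (sort (map z [0..<n])))"
    using sorted_nth_gt_iff[of "sort (map z [0..<n])" k t] assms by (simp add: order_stat_def)
  also have "length (filter (\<lambda>x. t < x) (sort (map z [0..<n]))) = length (filter (\<lambda>x. t < x) (map z [0..<n]))"
    by (simp flip: size_mset add: mset_filter)
  also have "\<dots> = card {i. i < n \<and> t < z i}"
    by (subst length_filter_conv_card) (auto intro!: arg_cong[where f=card])
  finally show ?thesis .
qed

lemma order_stat_in_values:
  assumes "1 \<le> k" "k \<le> n"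
  shows "\<exists>i<n. order_stat n z (n - k + 1) = z i"
proof -
  have "order_stat n z (n - k + 1) \<in> set (sort (map z [0..<n]))"
    unfolding order_stat_def using assms by (intro nth_mem) auto
  then show ?thesis by auto
qed

lemma order_stat_cong:
  "(\<And>i. i < n \<Longrightarrow> z i = z' i) \<Longrightarrow> order_stat n z r = order_stat n z' r"
  unfolding order_stat_def by (intro arg_cong2[where f="(!)"] arg_cong[where f=sort] map_cong) auto

lemma measurable_order_stat [measurable (raw)]:
  assumes z: "\<And>i. i < n \<Longrightarrow> (\<lambda>x. z x i) \<in> borel_measurable M" and k: "1 \<le> k" "k \<le> n"
  shows "(\<lambda>x. order_stat n (z x) (n - k + 1)) \<in> borel_measurable M"
  unfolding borel_measurable_iff_greater
proof
  fix a
  have "{x \<in> space M. a < order_stat n (z x) (n - k + 1)}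
      = {x \<in> space M. real k \<le> (\<Sum>i<n. indicat_real {a<..} (z x i))}"
    by (simp only: order_stat_gt_iff[OF k] of_nat_le_iff card_eq_sum_indicator[symmetric] greaterThan_iff)
  also have "\<dots> \<in> sets M"
    using z by measurable
  finally show "{x \<in> space M. a < order_stat n (z x) (n - k + 1)} \<in> sets M" .
qed

lemma K_set_eq:
  assumes "2 \<le> n"
  shows "K_set n = (\<lambda>j. 2 ^ j) ` {..nat \<lfloor>log 2 (real n / 2)\<rfloor>}"
proof -
  have "0 \<le> \<lfloor>log 2 (real n / 2)\<rfloor>" using assms by simp
  then show ?thesis unfolding K_set_def
    by (auto simp: image_iff nat_le_iff le_nat_iff)
qed

lemma finite_K_set: "2 \<le> n \<Longrightarrow> finite (K_set n)"
  and K_set_nonempty: "2 \<le> n \<Longrightarrow> K_set n \<noteq> {}"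
  by (simp_all add: K_set_eq)

lemma two_power_le_half:
  assumes "2 \<le> n" "j \<le> nat \<lfloor>log 2 (real n / 2)\<rfloor>"
  shows "2 ^ j \<le> real n / 2"
proof -
  have "0 \<le> log 2 (real n / 2)" using assms(1) by simp
  with assms(2) have "real j \<le> log 2 (real n / 2)" by (simp add: le_nat_iff le_floor_iff)
  then have "2 powr real j \<le> real n / 2" using assms(1) by (subst (asm) le_log_iff) auto
  then show ?thesis by (simp add: powr_realpow)
qed

lemma K_set_bounds:
  assumes "2 \<le> n" "k \<in> K_set n"
  shows "1 \<le> k" "real k \<le> real n / 2" "k \<le> n"
proof -
  obtain j where j: "k = 2 ^ j" "j \<le> nat \<lfloor>log 2 (real n / 2)\<rfloor>"
    using assms by (auto simp: K_set_eq)
  show "1 \<le> k" by (simp add: j)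
  show *: "real k \<le> real n / 2" using two_power_le_half[OF assms(1) j(2)] j(1) by simp
  then show "k \<le> n" by linarith
qed

lemma card_K_set_le:
  assumes "2 \<le> n"
  shows "real (card (K_set n)) \<le> log 2 (real n)"
proof -
  let ?J = "nat \<lfloor>log 2 (real n / 2)\<rfloor>"
  have "card (K_set n) \<le> Suc ?J"
    unfolding K_set_eq[OF assms] using card_image_le[of "{..?J}" "\<lambda>j. 2 ^ j :: nat"] by simp
  moreover have "0 \<le> log 2 (real n / 2)" using assms by simp
  then have "real ?J \<le> log 2 (real n / 2)" by linarith
  moreover have "log 2 (real n / 2) = log 2 (real n) - 1" using assms by (simp add: log_divide)
  ultimately show ?thesis by linarith
qed

text \<open>
  The largest power of 2 that is at most \<open>n / 2\<close>. At this index the null quantile stays in a compact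
  set, since the corresponding proportion of the sample lies between a quarter and a half.
\<close>

lemma K_set_large_element:
  assumes "2 \<le> n"
  obtains k where "k \<in> K_set n" "real n / 4 < real k"
proof
  let ?J = "nat \<lfloor>log 2 (real n / 2)\<rfloor>"
  show "2 ^ ?J \<in> K_set n" by (auto simp: K_set_eq[OF assms])
  have "log 2 (real n / 2) < real ?J + 1" by linarith
  then have "real n / 2 < 2 powr (real ?J + 1)" using assms by (subst (asm) log_less_iff) auto
  then show "real n / 4 < real (2 ^ ?J)" by (simp add: powr_add powr_realpow)
qed

lemma Psi2_eq_of_bool:
  assumes "2 \<le> n"
  shows "Psi2 \<alpha> n d s = of_bool (\<exists>k\<in>K_set n.
    order_quantile n (alpha_n n \<alpha>) k < order_stat n (projected n d s) (n - k + 1))"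
proof -
  let ?b = "\<lambda>k. order_stat n (projected n d s) (n - k + 1) > order_quantile n (alpha_n n \<alpha>) k"
  have ne: "(\<lambda>k. of_bool (?b k) :: nat) ` K_set n \<noteq> {}" and fin: "finite ((\<lambda>k. of_bool (?b k) :: nat) ` K_set n)"
    using finite_K_set[OF assms] K_set_nonempty[OF assms] by auto
  have "Psi2 \<alpha> n d s = Max ((\<lambda>k. of_bool (?b k)) ` K_set n)"
    unfolding Psi2_def Sup_nat_def using ne by simp
  also have "\<dots> = of_bool (\<exists>k\<in>K_set n. ?b k)"
    using fin ne by (intro Max_eqI) (auto simp: image_iff)
  finally show ?thesis .
qed

section \<open>Quantiles and the calibration of the level\<close>

context real_distribution
begin

lemma cdf_superlevel_bounds:
  assumes "0 < p" "p < 1"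
  shows "{t. p \<le> cdf M t} \<noteq> {}" "bdd_below {t. p \<le> cdf M t}"
proof -
  have "eventually (\<lambda>t. p < cdf M t) at_top"
    using cdf_lim_at_top_prob assms by (intro order_tendstoD(1)) auto
  then obtain t where "p < cdf M t" by (auto simp: eventually_at_top_linorder)
  then show "{t. p \<le> cdf M t} \<noteq> {}" by (auto intro: less_imp_le)
  have "eventually (\<lambda>t. cdf M t < p) at_bot"
    using cdf_lim_at_bot assms by (intro order_tendstoD(2)) auto
  then obtain b where b: "\<And>t. t \<le> b \<Longrightarrow> cdf M t < p" by (auto simp: eventually_at_bot_linorder)
  show "bdd_below {t. p \<le> cdf M t}"
    by (rule bdd_belowI[of _ b]) (use b in \<open>force simp: not_less[symmetric]\<close>)
qed

lemma quantile_le: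
  assumes "0 < p" "p < 1" "p \<le> cdf M t"
  shows "quantile M p \<le> t"
  unfolding quantile_def using cdf_superlevel_bounds[OF assms(1,2)] assms(3)
  by (intro cInf_lower) auto

text \<open>
  The infimum is attained because a distribution function is right continuous.
\<close>

lemma le_cdf_quantile:
  assumes "0 < p" "p < 1"
  shows "p \<le> cdf M (quantile M p)"
proof (rule ccontr)
  let ?q = "quantile M p"
  assume "\<not> p \<le> cdf M ?q"
  then have lt: "cdf M ?q < p" by simp
  then have "eventually (\<lambda>t. cdf M t < p) (at_right ?q)"
    using cdf_is_right_cont[of ?q] by (intro order_tendstoD(2)) (auto simp: continuous_within)
  then obtain b where b: "b > ?q" "\<And>t. ?q < t \<Longrightarrow> t < b \<Longrightarrow> cdf M t < p"
    by (auto simp: eventually_at_right_field)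
  obtain t where t: "p \<le> cdf M t" "t < b"
    using cInf_lessD[OF cdf_superlevel_bounds(1)[OF assms], of b] b(1) by (auto simp: quantile_def)
  have "?q \<le> t" using quantile_le[OF assms t(1)] .
  with b(2)[of t] lt t show False by (cases "t = ?q") auto
qed

lemma cdf_quantile:
  assumes "0 < p" "p < 1" and no_atoms: "\<And>x. measure M {x} = 0"
  shows "cdf M (quantile M p) = p"
proof (rule antisym)
  let ?q = "quantile M p"
  show "cdf M ?q \<le> p"
  proof (rule tendsto_upperbound)
    have "isCont (cdf M) ?q" using no_atoms by (simp add: isCont_cdf)
    then show "(cdf M \<longlongrightarrow> cdf M ?q) (at_left ?q)"
      unfolding isCont_def by (rule filterlim_mono) (auto intro: at_le)
    show "eventually (\<lambda>t. cdf M t \<le> p) (at_left ?q)"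
      using quantile_le[OF assms(1,2)]
      by (auto simp: eventually_at_left_field intro!: exI[of _ "?q - 1"]) (meson linear not_le)
  qed simp
qed (rule le_cdf_quantile[OF assms(1,2)])

end

text \<open>
  On \<open>[-T, T]\<close> the density is smallest at the end points.
\<close>

lemma std_normal_interval_ge:
  assumes "-T \<le> s" "s \<le> t" "t \<le> T"
  shows "std_normal_density T * (t - s) \<le> measure std_normal_distribution {s<..t}"
proof -
  interpret real_distribution std_normal_distribution by (rule real_dist_normal_dist)
  have "ennreal (std_normal_density T * (t - s)) = (\<integral>\<^sup>+x. ennreal (std_normal_density T) * indicator {s<..t} x \<partial>lborel)"
    using assms by (subst nn_integral_cmult_indicator) (auto simp: ennreal_mult)
  also have "\<dots> \<le> (\<integral>\<^sup>+x. ennreal (std_normal_density x) * indicator {s<..t} x \<partial>lborel)"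
  proof (intro nn_integral_mono)
    fix x
    have "std_normal_density T \<le> std_normal_density x" if "x \<in> {s<..t}"
    proof -
      have "\<bar>x\<bar> \<le> \<bar>T\<bar>" using that assms by auto
      then have "x\<^sup>2 \<le> T\<^sup>2" by (simp add: abs_le_square_iff)
      then show ?thesis by (simp add: normal_density_def divide_right_mono)
    qed
    then show "ennreal (std_normal_density T) * indicator {s<..t} x
        \<le> ennreal (std_normal_density x) * indicator {s<..t} x"
      by (auto simp: indicator_def ennreal_leI)
  qed
  also have "\<dots> = emeasure std_normal_distribution {s<..t}"
    by (rule emeasure_density[symmetric]) auto
  finally show ?thesis by (simp add: emeasure_eq_measure)
qed

lemma AE_std_normal_neq: "AE y in std_normal_distribution. y \<noteq> x"
  using AE_lborel_singleton[of x] by (subst AE_density) auto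

lemma std_normal_no_atoms: "measure std_normal_distribution {x} = 0"
proof -
  have "emeasure std_normal_distribution {x} = 0"
    using AE_std_normal_neq[of x] by (subst (asm) AE_iff_measurable[of "{x}"]) auto
  then show ?thesis by (simp add: measure_def)
qed

definition order_law :: "nat \<Rightarrow> nat \<Rightarrow> real measure" where
  "order_law n k = distr (gauss_sample n) borel (\<lambda>z. order_stat n z (n - k + 1))"

lemma prob_space_gauss_sample: "prob_space (gauss_sample n)"
  unfolding gauss_sample_eq_gauss_law by (rule prob_space_gauss_law)

lemma sets_gauss_sample [measurable_cong]: "sets (gauss_sample n) = sets (PiM {..<n} (\<lambda>_. borel))"
  unfolding gauss_sample_eq_gauss_law by (rule sets_gauss_law)

lemma measurable_order_stat_gauss [measurable]:
  assumes "1 \<le> k" "k \<le> n"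
  shows "(\<lambda>z. order_stat n z (n - k + 1)) \<in> borel_measurable (gauss_sample n)"
  by (rule measurable_order_stat[OF _ assms]) measurable

context
  fixes n k :: nat
  assumes k: "1 \<le> k" "k \<le> n"
begin

lemma real_distribution_order_law: "real_distribution (order_law n k)"
  unfolding order_law_def
  by (rule prob_space.real_distribution_distr[OF prob_space_gauss_sample measurable_order_stat_gauss[OF k]])

lemma measure_order_law:
  assumes "B \<in> sets borel"
  shows "measure (order_law n k) B = \<P>(z in gauss_sample n. order_stat n z (n - k + 1) \<in> B)"
  unfolding order_law_def using measurable_order_stat_gauss[OF k] assms
  by (subst measure_distr) (auto intro!: arg_cong[where f="measure _"])

lemma prob_order_stat_gt: "\<P>(z in gauss_sample n. t < order_stat n z (n - k + 1)) = 1 - cdf (order_law n k) t"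
proof -
  interpret real_distribution "order_law n k" by (rule real_distribution_order_law)
  have "\<P>(z in gauss_sample n. t < order_stat n z (n - k + 1)) = measure (order_law n k) {t<..}"
    by (subst measure_order_law) auto
  also have "{t<..} = UNIV - {..t}" by auto
  also have "measure (order_law n k) \<dots> = 1 - cdf (order_law n k) t"
    using prob_compl[of "{..t}"] by (simp add: cdf_def)
  finally show ?thesis .
qed

lemma order_law_no_atoms: "measure (order_law n k) {x} = 0"
proof -
  have "AE z in gauss_sample n. z i \<noteq> x" if "i < n" for i
    using that unfolding gauss_sample_def
    by (intro AE_PiM_component AE_std_normal_neq) (auto intro: prob_space_normal_density)
  then have "AE z in gauss_sample n. \<forall>i\<in>{..<n}. z i \<noteq> x"
    by (subst AE_finite_all) auto
  then have "AE z in gauss_sample n. order_stat n z (n - k + 1) \<notin> {x}"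
  proof eventually_elim
    fix z :: "nat \<Rightarrow> real" assume "\<forall>i\<in>{..<n}. z i \<noteq> x"
    then show "order_stat n z (n - k + 1) \<notin> {x}" using order_stat_in_values[OF k, of z] by auto
  qed
  then have "\<P>(z in gauss_sample n. order_stat n z (n - k + 1) \<in> {x}) = 0"
    using measurable_order_stat_gauss[OF k]
    by (subst prob_space.prob_eq_0[OF prob_space_gauss_sample]) auto
  then show ?thesis by (subst measure_order_law) auto
qed

text \<open>
  If the whole sample falls into \<open>(s, t]\<close>, so do all its order statistics; this has positive
  probability because the Gaussian density is positive.
\<close>

lemma order_law_cdf_strict_mono:
  assumes "s < t"
  shows "cdf (order_law n k) s < cdf (order_law n k) t"
proof -
  interpret real_distribution "order_law n k" by (rule real_distribution_order_law)
  interpret G: prob_space "gauss_sample n" by (rule prob_space_gauss_sample)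
  interpret N: real_distribution std_normal_distribution by (rule real_dist_normal_dist)
  interpret product_sigma_finite "\<lambda>i::nat. std_normal_distribution" ..
  have [measurable]: "(\<lambda>z. order_stat n z (n - k + 1)) \<in> borel_measurable (gauss_sample n)"
    by (rule measurable_order_stat_gauss[OF k])
  let ?T = "max \<bar>s\<bar> \<bar>t\<bar>"
  have "0 < std_normal_density ?T * (t - s)"
    using assms by (intro mult_pos_pos normal_density_pos) auto
  also have "\<dots> \<le> N.prob {s<..t}" using assms by (intro std_normal_interval_ge) auto
  finally have pos: "0 < N.prob {s<..t}" .
  have "emeasure (gauss_sample n) (PiE {..<n} (\<lambda>_. {s<..t})) = (\<Prod>i<n. emeasure std_normal_distribution {s<..t})"
    unfolding gauss_sample_def by (rule emeasure_PiM) auto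
  also have "\<dots> = ennreal (N.prob {s<..t} ^ n)"
    by (simp add: N.emeasure_eq_measure prod_ennreal ennreal_power)
  finally have "0 < G.prob (PiE {..<n} (\<lambda>_. {s<..t}))"
    using pos by (simp add: G.emeasure_eq_measure)
  also have "\<dots> \<le> \<P>(z in gauss_sample n. order_stat n z (n - k + 1) \<in> {s<..t})"
  proof (rule G.finite_measure_mono)
    show "PiE {..<n} (\<lambda>_. {s<..t}) \<subseteq> {z \<in> space (gauss_sample n). order_stat n z (n - k + 1) \<in> {s<..t}}"
    proof
      fix z assume z: "z \<in> PiE {..<n} (\<lambda>_. {s<..t})"
      obtain i where "i < n" "order_stat n z (n - k + 1) = z i"
        using order_stat_in_values[OF k] by blast
      with z show "z \<in> {z \<in> space (gauss_sample n). order_stat n z (n - k + 1) \<in> {s<..t}}"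
        by (auto simp: gauss_sample_def space_PiM PiE_iff)
    qed
  qed measurable
  also have "\<dots> = prob {s<..t}" by (subst measure_order_law) auto
  also have "\<dots> = cdf (order_law n k) t - cdf (order_law n k) s"
    using cdf_diff_eq[OF assms] by simp
  finally show ?thesis by simp
qed

lemma prob_order_stat_gt_quantile:
  assumes "0 < u" "u < 1"
  shows "\<P>(z in gauss_sample n. order_quantile n u k < order_stat n z (n - k + 1)) = u"
  using real_distribution.cdf_quantile[OF real_distribution_order_law _ _ order_law_no_atoms, of "1 - u"] assms
  unfolding prob_order_stat_gt by (simp add: order_quantile_def order_law_def)

lemma order_quantile_le:
  assumes "0 < u" "u < 1" "\<P>(z in gauss_sample n. t < order_stat n z (n - k + 1)) \<le> u"
  shows "order_quantile n u k \<le> t"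
  using real_distribution.quantile_le[OF real_distribution_order_law, of "1 - u" t] assms
  unfolding prob_order_stat_gt by (simp add: order_quantile_def order_law_def)

text \<open>
  As the distribution function is strictly increasing, slightly lowering the level raises the
  quantile only slightly. This continuity is what makes the supremum defining \<open>alpha_n\<close> attained.
\<close>

lemma order_quantile_left_continuous:
  assumes u: "0 < u" "u < 1" and t: "order_quantile n u k < t"
  obtains \<delta> where "0 < \<delta>" "\<And>u'. u - \<delta> < u' \<Longrightarrow> 0 < u' \<Longrightarrow> u' < 1 \<Longrightarrow> order_quantile n u' k \<le> t"
proof
  let ?\<delta> = "u - \<P>(z in gauss_sample n. t < order_stat n z (n - k + 1))"
  show "0 < ?\<delta>"
    using prob_order_stat_gt_quantile[OF u] order_law_cdf_strict_mono[OF t]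
    unfolding prob_order_stat_gt by linarith
  show "order_quantile n u' k \<le> t" if "u - ?\<delta> < u'" "0 < u'" "u' < 1" for u'
    using that by (intro order_quantile_le) auto
qed

end

definition null_rejection :: "nat \<Rightarrow> real \<Rightarrow> real" where
  "null_rejection n u = \<P>(z in gauss_sample n. \<exists>k\<in>K_set n. order_quantile n u k < order_stat n z (n - k + 1))"

lemma alpha_n_eq: "alpha_n n \<alpha> = Sup {u \<in> {0<..<1}. null_rejection n u \<le> \<alpha>}"
  by (simp add: alpha_n_def null_rejection_def)

context
  fixes n :: nat
  assumes n: "2 \<le> n"
begin

lemma measurable_order_stat_K_set [measurable]:
  "k \<in> K_set n \<Longrightarrow> (\<lambda>z. order_stat n z (n - k + 1)) \<in> borel_measurable (gauss_sample n)"
  using K_set_bounds[OF n] by (intro measurable_order_stat_gauss) auto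

lemma order_stat_gt_sets:
  "k \<in> K_set n \<Longrightarrow> {z \<in> space (gauss_sample n). c < order_stat n z (n - k + 1)} \<in> sets (gauss_sample n)"
  by (rule borel_measurable_iff_greater[THEN iffD1, rule_format, OF measurable_order_stat_K_set])

lemma rejection_sets:
  "{z \<in> space (gauss_sample n). \<exists>k\<in>K_set n. c k < order_stat n z (n - k + 1)} \<in> sets (gauss_sample n)"
proof -
  have "{z \<in> space (gauss_sample n). \<exists>k\<in>K_set n. c k < order_stat n z (n - k + 1)}
      = (\<Union>k\<in>K_set n. {z \<in> space (gauss_sample n). c k < order_stat n z (n - k + 1)})"
    by auto
  also have "\<dots> \<in> sets (gauss_sample n)"
    using finite_K_set[OF n] order_stat_gt_sets by (intro sets.finite_UN)
  finally show ?thesis .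
qed

text \<open>
  The lower bound comes from a single index, the upper bound from the union over all of them; both
  use that each individual test has exact level \<open>u\<close>.
\<close>

lemma null_rejection_bounds:
  assumes "0 < u" "u < 1"
  shows "u \<le> null_rejection n u" "null_rejection n u \<le> real (card (K_set n)) * u"
proof -
  interpret prob_space "gauss_sample n" by (rule prob_space_gauss_sample)
  let ?E = "\<lambda>k. {z \<in> space (gauss_sample n). order_quantile n u k < order_stat n z (n - k + 1)}"
  have E: "prob (?E k) = u" "?E k \<in> sets (gauss_sample n)" if "k \<in> K_set n" for k
    using K_set_bounds[OF n that] prob_order_stat_gt_quantile[of k n u] assms
      order_stat_gt_sets[OF that] by simp_all
  obtain k where k: "k \<in> K_set n" using K_set_nonempty[OF n] by auto
  have "prob (?E k) \<le> null_rejection n u"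
    unfolding null_rejection_def using k by (intro finite_measure_mono rejection_sets) auto
  with E(1)[OF k] show "u \<le> null_rejection n u" by simp
  have "null_rejection n u = prob (\<Union>k\<in>K_set n. ?E k)"
    unfolding null_rejection_def by (intro arg_cong[where f=prob]) auto
  also have "\<dots> \<le> (\<Sum>k\<in>K_set n. prob (?E k))"
    using E(2) finite_K_set[OF n] by (intro finite_measure_subadditive_finite) auto
  also have "\<dots> = real (card (K_set n)) * u" using E(1) by simp
  finally show "null_rejection n u \<le> real (card (K_set n)) * u" .
qed

lemma
  assumes \<alpha>: "0 < \<alpha>" "\<alpha> < 1"
  shows alpha_n_ge: "\<alpha> / real (card (K_set n)) \<le> alpha_n n \<alpha>"
    and alpha_n_pos: "0 < alpha_n n \<alpha>"
    and alpha_n_le: "alpha_n n \<alpha> \<le> \<alpha>"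
    and alpha_n_approx: "u0 < alpha_n n \<alpha> \<Longrightarrow> \<exists>u. 0 < u \<and> u < 1 \<and> null_rejection n u \<le> \<alpha> \<and> u0 < u"
proof -
  let ?S = "{u \<in> {0<..<1}. null_rejection n u \<le> \<alpha>}"
  have card: "1 \<le> card (K_set n)"
    using finite_K_set[OF n] K_set_nonempty[OF n] by (simp add: Suc_le_eq card_gt_0_iff)
  then have pos: "0 < \<alpha> / real (card (K_set n))" using \<alpha> by simp
  have le: "u \<le> \<alpha>" if "u \<in> ?S" for u using null_rejection_bounds(1)[of u] that by auto
  have "\<alpha> / real (card (K_set n)) \<le> \<alpha> / 1"
    using \<alpha> card by (intro divide_left_mono) auto
  with \<alpha> have "\<alpha> / real (card (K_set n)) < 1" by simp
  with pos have S: "\<alpha> / real (card (K_set n)) \<in> ?S"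
    using null_rejection_bounds(2)[of "\<alpha> / real (card (K_set n))"] card by auto
  have bdd: "bdd_above ?S" using le by (intro bdd_aboveI[of _ \<alpha>])
  show ge: "\<alpha> / real (card (K_set n)) \<le> alpha_n n \<alpha>"
    unfolding alpha_n_eq using S bdd by (rule cSup_upper)
  with pos show "0 < alpha_n n \<alpha>" by simp
  have "?S \<noteq> {}" using S by blast
  then show "alpha_n n \<alpha> \<le> \<alpha>" unfolding alpha_n_eq using le by (rule cSup_least)
  show "\<exists>u. 0 < u \<and> u < 1 \<and> null_rejection n u \<le> \<alpha> \<and> u0 < u" if "u0 < alpha_n n \<alpha>"
  proof -
    have "?S \<noteq> {}" using S by blast
    from less_cSupD[OF this that[unfolded alpha_n_eq]] obtain u where "u \<in> ?S" "u0 < u" by blast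
    then show ?thesis by (intro exI[of _ u]) simp
  qed
qed

text \<open>
  The rejection event at the level \<open>alpha_n n \<alpha>\<close> is the increasing union of the events \<open>E m\<close> in which
  some quantile is exceeded by more than \<open>1 / (m + 1)\<close>. By continuity of the quantiles, each \<open>E m\<close> is
  contained in the rejection event at some admissible \<open>u\<close> close to the supremum, hence has probability
  at most \<open>\<alpha>\<close>, and this bound passes to the limit.
\<close>

lemma null_rejection_alpha_n_le:
  assumes \<alpha>: "0 < \<alpha>" "\<alpha> < 1"
  shows "null_rejection n (alpha_n n \<alpha>) \<le> \<alpha>"
proof -
  interpret prob_space "gauss_sample n" by (rule prob_space_gauss_sample)
  let ?a = "alpha_n n \<alpha>"
  have a: "0 < ?a" "?a < 1" using alpha_n_pos[OF \<alpha>] alpha_n_le[OF \<alpha>] \<alpha> by auto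
  define E where "E m = {z \<in> space (gauss_sample n). \<exists>k\<in>K_set n.
    order_quantile n ?a k + 1 / real (Suc m) < order_stat n z (n - k + 1)}" for m
  have E_le: "prob (E m) \<le> \<alpha>" for m
  proof -
    have "\<exists>\<delta>>0. \<forall>u'. ?a - \<delta> < u' \<longrightarrow> 0 < u' \<longrightarrow> u' < 1 \<longrightarrow>
        order_quantile n u' k \<le> order_quantile n ?a k + 1 / real (Suc m)" if "k \<in> K_set n" for k
      using order_quantile_left_continuous[of k n ?a "order_quantile n ?a k + 1 / real (Suc m)"]
        K_set_bounds[OF n that] a by (metis less_add_same_cancel1 of_nat_0_less_iff zero_less_Suc zero_less_divide_1_iff)
    then obtain \<delta> where \<delta>: "\<And>k. k \<in> K_set n \<Longrightarrow> 0 < \<delta> k"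
      "\<And>k u'. k \<in> K_set n \<Longrightarrow> ?a - \<delta> k < u' \<Longrightarrow> 0 < u' \<Longrightarrow> u' < 1 \<Longrightarrow>
        order_quantile n u' k \<le> order_quantile n ?a k + 1 / real (Suc m)"
      by metis
    \<comment> \<open>One \<open>u\<close> must serve all indices at once; this is possible because there are finitely many.\<close>
    let ?\<delta> = "Min (\<delta> ` K_set n)"
    have fin: "finite (\<delta> ` K_set n)" "\<delta> ` K_set n \<noteq> {}"
      using finite_K_set[OF n] K_set_nonempty[OF n] by auto
    then have "0 < ?\<delta>" using \<delta>(1) by (subst Min_gr_iff) auto
    then obtain u where u: "0 < u" "u < 1" "null_rejection n u \<le> \<alpha>" "?a - ?\<delta> < u"
      using alpha_n_approx[OF \<alpha>, of "?a - ?\<delta>"] by auto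
    have q: "order_quantile n u k \<le> order_quantile n ?a k + 1 / real (Suc m)" if "k \<in> K_set n" for k
    proof (rule \<delta>(2)[OF that _ u(1,2)])
      have "?\<delta> \<le> \<delta> k" using fin that by simp
      with u(4) show "?a - \<delta> k < u" by linarith
    qed
    have "prob (E m) \<le> null_rejection n u"
      unfolding null_rejection_def E_def
      by (intro finite_measure_mono rejection_sets) (use q in \<open>force intro: le_less_trans\<close>)
    with u(3) show ?thesis by simp
  qed
  have "incseq E"
  proof (rule incseq_SucI)
    fix m
    have "1 / real (Suc (Suc m)) \<le> 1 / real (Suc m)" by (intro divide_left_mono) auto
    then show "E m \<subseteq> E (Suc m)" unfolding E_def by force
  qed
  moreover have "range E \<subseteq> sets (gauss_sample n)" unfolding E_def using rejection_sets by auto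
  ultimately have "(\<lambda>m. prob (E m)) \<longlonglongrightarrow> prob (\<Union>m. E m)" by (rule finite_Lim_measure_incseq[rotated])
  moreover have "(\<Union>m. E m) = {z \<in> space (gauss_sample n). \<exists>k\<in>K_set n. order_quantile n ?a k < order_stat n z (n - k + 1)}"
  proof (intro equalityI subsetI)
    fix z assume "z \<in> {z \<in> space (gauss_sample n). \<exists>k\<in>K_set n. order_quantile n ?a k < order_stat n z (n - k + 1)}"
    then obtain k where k: "z \<in> space (gauss_sample n)" "k \<in> K_set n"
      and "0 < order_stat n z (n - k + 1) - order_quantile n ?a k" by auto
    then obtain m where "inverse (real (Suc m)) < order_stat n z (n - k + 1) - order_quantile n ?a k"
      using reals_Archimedean by blast
    then have "order_quantile n ?a k + 1 / real (Suc m) < order_stat n z (n - k + 1)"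
      by (simp add: inverse_eq_divide)
    with k show "z \<in> (\<Union>m. E m)" unfolding E_def by blast
  next
    fix z assume "z \<in> (\<Union>m. E m)"
    then obtain m k where "z \<in> space (gauss_sample n)" "k \<in> K_set n"
      "order_quantile n ?a k + 1 / real (Suc m) < order_stat n z (n - k + 1)"
      unfolding E_def by blast
    moreover from this(3) have "order_quantile n ?a k < order_stat n z (n - k + 1)"
      by (rule le_less_trans[rotated]) simp
    ultimately show "z \<in> {z \<in> space (gauss_sample n). \<exists>k\<in>K_set n. order_quantile n ?a k < order_stat n z (n - k + 1)}"
      by blast
  qed
  ultimately show ?thesis
    unfolding null_rejection_def using E_le by (intro LIMSEQ_le_const2) auto
qed

end

section \<open>The level of the test\<close>

text \<open>
  Conditioning on the first half of the sample: outside a bad event of probability at most \<open>b1\<close>, the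
  section of \<open>S\<close> has probability at most \<open>b2\<close>. It is used for the level with \<open>b1 = 0\<close>, the bad event
  being a vanishing sample mean, and for the power, the bad event being a poor direction.
\<close>

lemma measure_pair_measure_le:
  assumes "prob_space M" "prob_space N"
    and E [measurable]: "E \<in> sets M" and S [measurable]: "S \<in> sets (M \<Otimes>\<^sub>M N)"
    and b1: "measure M (space M - E) \<le> b1" and b2: "0 \<le> b2"
    and sect: "\<And>x. x \<in> E \<Longrightarrow> measure N {y \<in> space N. (x, y) \<in> S} \<le> b2"
  shows "measure (M \<Otimes>\<^sub>M N) S \<le> b1 + b2"
proof -
  interpret M: prob_space M by fact
  interpret N: prob_space N by fact
  interpret MN: pair_prob_space M N ..
  have "emeasure (M \<Otimes>\<^sub>M N) S = (\<integral>\<^sup>+x. emeasure N (Pair x -` S) \<partial>M)"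
    by (rule N.emeasure_pair_measure_alt) fact
  also have "\<dots> \<le> (\<integral>\<^sup>+x. indicator (space M - E) x + ennreal b2 \<partial>M)"
  proof (rule nn_integral_mono)
    fix x assume x: "x \<in> space M"
    show "emeasure N (Pair x -` S) \<le> indicator (space M - E) x + ennreal b2"
    proof (cases "x \<in> E")
      case True
      have "Pair x -` S = {y \<in> space N. (x, y) \<in> S}"
        using sets.sets_into_space[OF S] by (auto simp: space_pair_measure)
      then show ?thesis using sect[OF True] b2 True
        by (simp add: N.emeasure_eq_measure ennreal_leI)
    next
      case False
      with x have "indicator (space M - E) x = (1 :: ennreal)" by simp
      then show ?thesis using N.emeasure_le_1[of "Pair x -` S"]
        by (simp add: add_increasing2)
    qed
  qed
  also have "\<dots> = ennreal (measure M (space M - E)) + ennreal b2"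
    by (subst nn_integral_add) (auto simp: M.emeasure_eq_measure M.prob_space)
  also have "\<dots> \<le> ennreal (b1 + b2)"
    using b1 b2 by (simp flip: ennreal_plus add: ennreal_leI)
  finally have "ennreal (measure (M \<Otimes>\<^sub>M N) S) \<le> ennreal (b1 + b2)"
    by (simp add: MN.emeasure_eq_measure)
  moreover have "0 \<le> b1 + b2" using b1 b2 measure_nonneg[of M "space M - E"] by linarith
  ultimately show ?thesis by (simp add: ennreal_le_iff)
qed

lemma sets_PiM_vectors:
  "(\<And>i. i < n \<Longrightarrow> sets (P i) = sets (PiM {..<d} (\<lambda>_. borel))) \<Longrightarrow>
    sets (PiM {..<n} P) = sets (\<Pi>\<^sub>M i\<in>{..<n}. \<Pi>\<^sub>M j\<in>{..<d}. borel)"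
  by (rule sets_PiM_cong) auto

lemma measurable_vector_coordinate:
  "i < n \<Longrightarrow> j < d \<Longrightarrow> (\<lambda>y. y i j :: real) \<in> borel_measurable (\<Pi>\<^sub>M i\<in>{..<n}. \<Pi>\<^sub>M j\<in>{..<d}. borel)"
  by (rule measurable_compose[where f="\<lambda>y. y i" and g="\<lambda>x. x j" and N="\<Pi>\<^sub>M j\<in>{..<d}. borel"]) auto

lemma measurable_sample_mean [measurable]:
  "j < d \<Longrightarrow> (\<lambda>A. sample_mean n A j) \<in> borel_measurable (\<Pi>\<^sub>M i\<in>{..<n}. \<Pi>\<^sub>M j\<in>{..<d}. borel)"
  supply measurable_vector_coordinate [measurable]
  unfolding sample_mean_def by measurable

lemma measurable_norm_sample_mean [measurable]:
  "(\<lambda>A. norm_d d (sample_mean n A)) \<in> borel_measurable (\<Pi>\<^sub>M i\<in>{..<n}. \<Pi>\<^sub>M j\<in>{..<d}. borel)"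
  unfolding norm_d_def L2_set_def by measurable

lemma measurable_inner_sample_mean [measurable]:
  "(\<lambda>A. inner_d d (sample_mean n A) w) \<in> borel_measurable (\<Pi>\<^sub>M i\<in>{..<n}. \<Pi>\<^sub>M j\<in>{..<d}. borel)"
  unfolding inner_d_def by measurable

lemma measurable_projected:
  assumes "i < n"
  shows "(\<lambda>s. projected n d s i) \<in> borel_measurable
    ((\<Pi>\<^sub>M i\<in>{..<n}. \<Pi>\<^sub>M j\<in>{..<d}. borel) \<Otimes>\<^sub>M (\<Pi>\<^sub>M i\<in>{..<n}. \<Pi>\<^sub>M j\<in>{..<d}. borel))"
  supply measurable_vector_coordinate [measurable]
  unfolding projected_def direction_def inner_d_def using assms by measurable

lemma Psi2_measurable:
  assumes n: "2 \<le> n"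
    and P: "sets P = sets (PiM {..<d} (\<lambda>_. borel))"
  shows "Psi2 \<alpha> n d \<in> (\<Pi>\<^sub>M i\<in>{..<n}. P) \<Otimes>\<^sub>M (\<Pi>\<^sub>M i\<in>{..<n}. P) \<rightarrow>\<^sub>M count_space UNIV"
proof -
  let ?U = "\<Pi>\<^sub>M i\<in>{..<n}. \<Pi>\<^sub>M j\<in>{..<d}. (borel :: real measure)"
  have sets: "sets ((\<Pi>\<^sub>M i\<in>{..<n}. P) \<Otimes>\<^sub>M (\<Pi>\<^sub>M i\<in>{..<n}. P)) = sets (?U \<Otimes>\<^sub>M ?U)"
    using sets_PiM_vectors[of n "\<lambda>_. P" d] P by (intro sets_pair_measure_cong) auto
  have "Measurable.pred (?U \<Otimes>\<^sub>M ?U) (\<lambda>s. \<exists>k\<in>K_set n.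
      order_quantile n (alpha_n n \<alpha>) k < order_stat n (projected n d s) (n - k + 1))"
  proof (rule pred_intros_finite(4)[OF finite_K_set[OF n]])
    fix k assume k: "k \<in> K_set n"
    have "(\<lambda>s. order_stat n (projected n d s) (n - k + 1)) \<in> borel_measurable (?U \<Otimes>\<^sub>M ?U)"
      using K_set_bounds[OF n k] by (intro measurable_order_stat measurable_projected)
    then show "Measurable.pred (?U \<Otimes>\<^sub>M ?U) (\<lambda>s. order_quantile n (alpha_n n \<alpha>) k < order_stat n (projected n d s) (n - k + 1))"
      unfolding borel_measurable_iff_greater pred_def by blast
  qed
  then have "(\<lambda>s. of_bool (\<exists>k\<in>K_set n. order_quantile n (alpha_n n \<alpha>) k
      < order_stat n (projected n d s) (n - k + 1)) :: nat) \<in> ?U \<Otimes>\<^sub>M ?U \<rightarrow>\<^sub>M count_space UNIV"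
    by (rule measurable_compose[where N="count_space UNIV"]) simp
  then have "Psi2 \<alpha> n d \<in> ?U \<Otimes>\<^sub>M ?U \<rightarrow>\<^sub>M count_space UNIV"
    unfolding Psi2_eq_of_bool[OF n, abs_def] .
  then show ?thesis by (subst measurable_cong_sets[OF sets refl])
qed

lemma sample_law_mixture:
  "sample_law n d (mixture_density d \<epsilon> \<mu>)
    = (\<Pi>\<^sub>M i\<in>{..<n}. mixture_law d \<epsilon> \<mu>) \<Otimes>\<^sub>M (\<Pi>\<^sub>M i\<in>{..<n}. mixture_law d \<epsilon> \<mu>)"
  by (simp add: sample_law_def mixture_law_def)

lemma sample_law_gauss:
  "sample_law n d (gauss_density d)
    = (\<Pi>\<^sub>M i\<in>{..<n}. gauss_law d (\<lambda>_. 0)) \<Otimes>\<^sub>M (\<Pi>\<^sub>M i\<in>{..<n}. gauss_law d (\<lambda>_. 0))"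
  by (simp add: sample_law_def density_gauss_density)

lemma norm_direction:
  assumes "norm_d d (sample_mean n A) \<noteq> 0"
  shows "norm_d d (direction n d A) = 1"
proof -
  have "(norm_d d (direction n d A))\<^sup>2 = (\<Sum>j<d. (sample_mean n A j)\<^sup>2) / (norm_d d (sample_mean n A))\<^sup>2"
    by (subst norm_d_power2) (simp only: direction_def power_divide sum_divide_distrib)
  also have "\<dots> = 1" using assms by (simp add: norm_d_power2[symmetric])
  finally show ?thesis using norm_d_nonneg[of d "direction n d A"] by (simp add: power2_eq_1_iff)
qed

text \<open>
  Rotation invariance: the law of the projections does not depend on the unit vector \<open>v\<close>.
\<close>

lemma distr_projection_gauss:
  assumes v: "norm_d d v = 1"
  shows "distr (\<Pi>\<^sub>M i\<in>{..<n}. gauss_law d (\<lambda>_. 0)) (\<Pi>\<^sub>M i\<in>{..<n}. borel)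
      (compose {..<n} (\<lambda>x. inner_d d x v)) = gauss_sample n"
proof -
  have "norm_d d v \<noteq> 0" "inner_d d (\<lambda>_. 0) v = 0" using v by (simp_all add: inner_d_def)
  then have D: "distributed (gauss_law d (\<lambda>_. 0)) lborel (\<lambda>x. inner_d d x v) std_normal_density"
    using distributed_inner_d_gauss_law[of d v "\<lambda>_. 0"] v by simp
  have "distr (gauss_law d (\<lambda>_. 0)) std_normal_distribution (\<lambda>x. inner_d d x v)
      = distr (gauss_law d (\<lambda>_. 0)) lborel (\<lambda>x. inner_d d x v)"
    by (rule distr_cong) auto
  also have "\<dots> = std_normal_distribution" using D by (simp add: distributed_def)
  finally have 1: "distr (gauss_law d (\<lambda>_. 0)) std_normal_distribution (\<lambda>x. inner_d d x v) = std_normal_distribution" .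
  have "distr (\<Pi>\<^sub>M i\<in>{..<n}. gauss_law d (\<lambda>_. 0)) (\<Pi>\<^sub>M i\<in>{..<n}. borel) (compose {..<n} (\<lambda>x. inner_d d x v))
      = distr (\<Pi>\<^sub>M i\<in>{..<n}. gauss_law d (\<lambda>_. 0)) (\<Pi>\<^sub>M i\<in>{..<n}. std_normal_distribution) (compose {..<n} (\<lambda>x. inner_d d x v))"
    by (rule distr_cong) (auto intro!: sets_PiM_cong)
  also have "\<dots> = (\<Pi>\<^sub>M i\<in>{..<n}. distr (gauss_law d (\<lambda>_. 0)) std_normal_distribution (\<lambda>x. inner_d d x v))"
  proof (rule distr_PiM_finite_prob_space')
    show "(\<lambda>x. inner_d d x v) \<in> gauss_law d (\<lambda>_. 0) \<rightarrow>\<^sub>M std_normal_distribution" by measurable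
  qed (auto intro: prob_space_gauss_law prob_space_normal_density)
  also have "\<dots> = gauss_sample n" by (simp add: 1 gauss_sample_def)
  finally show ?thesis .
qed

lemma measurable_compose_inner [measurable]:
  "compose {..<n} (\<lambda>x. inner_d d x v) \<in> (\<Pi>\<^sub>M i\<in>{..<n}. gauss_law d \<mu>) \<rightarrow>\<^sub>M (\<Pi>\<^sub>M i\<in>{..<n}. borel)"
  unfolding compose_def by measurable

text \<open>
  It is enough that the first coordinate of the sample mean is almost surely nonzero: the first
  coordinates of the sample are i.i.d. standard Gaussian, so their sum has a density.
\<close>

lemma prob_sample_mean_zero:
  assumes n: "0 < n" and d: "0 < d"
  shows "measure (\<Pi>\<^sub>M i\<in>{..<n}. gauss_law d (\<lambda>_. 0))
      {A \<in> space (\<Pi>\<^sub>M i\<in>{..<n}. gauss_law d (\<lambda>_. 0)). norm_d d (sample_mean n A) = 0} = 0"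
proof -
  let ?Q = "\<Pi>\<^sub>M i\<in>{..<n}. gauss_law d (\<lambda>_. 0)"
  interpret Q: prob_space ?Q by (intro prob_space_PiM prob_space_gauss_law)
  have sets_Q [measurable_cong]: "sets ?Q = sets (\<Pi>\<^sub>M i\<in>{..<n}. \<Pi>\<^sub>M j\<in>{..<d}. (borel :: real measure))"
    by (rule sets_PiM_vectors) (rule sets_gauss_law)
  let ?e = "unit_vec 0"
  have in_e: "inner_d d x ?e = x 0" for x using d by (rule inner_d_unit_vec)
  have norm_e: "norm_d d ?e = 1" using d by (rule norm_d_unit_vec)
  have one: "(norm_d n (\<lambda>_. 1))\<^sup>2 = real n" by (simp add: norm_d_power2)
  then have "norm_d n (\<lambda>_. 1) \<noteq> 0" using n by auto
  then have D: "distributed (gauss_sample n) lborel (\<lambda>z. inner_d n z (\<lambda>_. 1))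
      (normal_density (inner_d n (\<lambda>_. 0) (\<lambda>_. 1)) (norm_d n (\<lambda>_. 1)))"
    unfolding gauss_sample_eq_gauss_law by (rule distributed_inner_d_gauss_law)
  have "AE x in density lborel (normal_density (inner_d n (\<lambda>_. 0) (\<lambda>_. 1)) (norm_d n (\<lambda>_. 1))). x \<noteq> 0"
    using AE_lborel_singleton[of "0::real"] by (subst AE_density) auto
  then have "AE x in distr (gauss_sample n) lborel (\<lambda>z. inner_d n z (\<lambda>_. 1)). x \<noteq> 0"
    unfolding distributed_distr_eq_density[OF D] .
  then have "AE z in gauss_sample n. inner_d n z (\<lambda>_. 1) \<noteq> 0"
    by (rule AE_distrD[rotated]) measurable
  then have "AE A in ?Q. inner_d n (compose {..<n} (\<lambda>x. inner_d d x ?e) A) (\<lambda>_. 1) \<noteq> 0"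
    unfolding distr_projection_gauss[OF norm_e, symmetric] by (rule AE_distrD[rotated]) measurable
  then have "AE A in ?Q. norm_d d (sample_mean n A) \<noteq> 0"
  proof eventually_elim
    fix A :: "nat \<Rightarrow> nat \<Rightarrow> real"
    assume A: "inner_d n (compose {..<n} (\<lambda>x. inner_d d x ?e) A) (\<lambda>_. 1) \<noteq> 0"
    have "inner_d n (compose {..<n} (\<lambda>x. inner_d d x ?e) A) (\<lambda>_. 1) = (\<Sum>i<n. A i 0)"
      unfolding inner_d_def[of n] by (rule sum.cong) (auto simp: compose_def in_e)
    with A have "sample_mean n A 0 \<noteq> 0" using n by (simp add: sample_mean_def)
    with d have "0 < (\<Sum>j<d. (sample_mean n A j)\<^sup>2)"
      by (intro sum_pos2[of _ 0]) auto
    then show "norm_d d (sample_mean n A) \<noteq> 0" unfolding norm_d_power2[symmetric] by auto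
  qed
  then show ?thesis
    by (subst Q.prob_eq_0) auto
qed

lemma Psi2_level:
  assumes n: "2 \<le> n" and d: "1 \<le> d" and \<alpha>: "0 < \<alpha>" "\<alpha> < 1"
  shows "test_of_level \<alpha> n d (Psi2 \<alpha> n d)"
proof -
  let ?Q = "\<Pi>\<^sub>M i\<in>{..<n}. gauss_law d (\<lambda>_. 0)"
  have sets_Q [measurable_cong]: "sets ?Q = sets (\<Pi>\<^sub>M i\<in>{..<n}. \<Pi>\<^sub>M j\<in>{..<d}. (borel :: real measure))"
    by (rule sets_PiM_vectors) (rule sets_gauss_law)
  have pQ: "prob_space ?Q" by (intro prob_space_PiM prob_space_gauss_law)
  have meas: "Psi2 \<alpha> n d \<in> ?Q \<Otimes>\<^sub>M ?Q \<rightarrow>\<^sub>M count_space UNIV"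
    by (rule Psi2_measurable[OF n sets_gauss_law])
  have range: "Psi2 \<alpha> n d s \<in> {0, 1}" for s
    unfolding Psi2_eq_of_bool[OF n] by simp
  have "Psi2 \<alpha> n d \<in> ?Q \<Otimes>\<^sub>M ?Q \<rightarrow>\<^sub>M count_space {0, 1}"
    using measurable_restrict_space2[OF _ meas, of "{0, 1}"] range
    by (simp add: restrict_count_space)
  moreover have "measure (?Q \<Otimes>\<^sub>M ?Q) {s \<in> space (?Q \<Otimes>\<^sub>M ?Q). Psi2 \<alpha> n d s = 1} \<le> 0 + \<alpha>"
  proof (rule measure_pair_measure_le[OF pQ pQ])
    let ?E = "{A \<in> space ?Q. norm_d d (sample_mean n A) \<noteq> 0}"
    show "?E \<in> sets ?Q" by measurable
    have "space ?Q - ?E = {A \<in> space ?Q. norm_d d (sample_mean n A) = 0}" by auto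
    then show "measure ?Q (space ?Q - ?E) \<le> 0"
      using prob_sample_mean_zero[of n d] n d by simp
    show "{s \<in> space (?Q \<Otimes>\<^sub>M ?Q). Psi2 \<alpha> n d s = 1} \<in> sets (?Q \<Otimes>\<^sub>M ?Q)"
      using measurable_sets[OF meas, of "{1}"] by (simp add: vimage_def Int_def conj_commute)
    fix A assume A: "A \<in> ?E"
    let ?v = "direction n d A"
    let ?R = "{z \<in> space (gauss_sample n). \<exists>k\<in>K_set n. order_quantile n (alpha_n n \<alpha>) k < order_stat n z (n - k + 1)}"
    let ?c = "compose {..<n} (\<lambda>x. inner_d d x ?v)"
    have v: "norm_d d ?v = 1" using A by (intro norm_direction) auto
    have sp: "space (gauss_sample n) = space (\<Pi>\<^sub>M i\<in>{..<n}. borel)"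
      by (rule sets_eq_imp_space_eq) (rule sets_gauss_sample)
    have c: "?c \<in> ?Q \<rightarrow>\<^sub>M (\<Pi>\<^sub>M i\<in>{..<n}. borel)" by (rule measurable_compose_inner)
    let ?S = "{y \<in> space ?Q. (A, y) \<in> {s \<in> space (?Q \<Otimes>\<^sub>M ?Q). Psi2 \<alpha> n d s = 1}}"
    have eq: "?S = ?c -` ?R \<inter> space ?Q"
    proof -
      have "Psi2 \<alpha> n d (A, y) = 1 \<longleftrightarrow> ?c y \<in> ?R" if "y \<in> space ?Q" for y
      proof -
        have "order_stat n (projected n d (A, y)) r = order_stat n (?c y) r" for r
          by (rule order_stat_cong) (auto simp: projected_def compose_def)
        moreover have "?c y \<in> space (gauss_sample n)"
          unfolding sp using c that by (rule measurable_space)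
        ultimately show ?thesis unfolding Psi2_eq_of_bool[OF n] by simp
      qed
      with A show ?thesis by (auto simp: space_pair_measure)
    qed
    have "measure ?Q ?S = measure (distr ?Q (\<Pi>\<^sub>M i\<in>{..<n}. borel) ?c) ?R"
      unfolding eq using rejection_sets[OF n, of "order_quantile n (alpha_n n \<alpha>)"] c
      by (subst measure_distr) (auto simp: sets_gauss_sample)
    also have "\<dots> = null_rejection n (alpha_n n \<alpha>)"
      unfolding distr_projection_gauss[OF v] null_rejection_def ..
    also have "\<dots> \<le> \<alpha>" by (rule null_rejection_alpha_n_le[OF n \<alpha>])
    finally show "measure ?Q ?S \<le> \<alpha>" .
  qed (use \<alpha> in auto)
  ultimately show ?thesis
    unfolding test_of_level_def sample_law_gauss by simp
qed

section \<open>The estimated direction and the projected sample\<close>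

lemma norm_d_eq_0_imp: "norm_d d x = 0 \<Longrightarrow> i < d \<Longrightarrow> x i = 0"
  using norm_d_power2[of d x] by (auto simp: sum_nonneg_eq_0_iff)

lemma inner_direction:
  "inner_d d \<mu> (direction n d A) = inner_d d (sample_mean n A) \<mu> / norm_d d (sample_mean n A)"
  unfolding inner_d_def direction_def by (simp add: sum_divide_distrib mult.commute)

context
  fixes n d :: nat and \<epsilon> :: real and \<mu> :: "nat \<Rightarrow> real"
  assumes n: "0 < n" and \<epsilon>: "0 < \<epsilon>" "\<epsilon> < 1" and \<mu>: "norm_d d \<mu> \<noteq> 0"
begin

lemma sets_mixture_sample [measurable_cong]:
  "sets (\<Pi>\<^sub>M i\<in>{..<n}. mixture_law d \<epsilon> \<mu>) = sets (\<Pi>\<^sub>M i\<in>{..<n}. \<Pi>\<^sub>M j\<in>{..<d}. borel)"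
  by (rule sets_PiM_vectors) (rule sets_mixture_law)

lemma prob_space_mixture_sample: "prob_space (\<Pi>\<^sub>M i\<in>{..<n}. mixture_law d \<epsilon> \<mu>)"
  using \<epsilon> by (intro prob_space_PiM prob_space_mixture_law) auto

text \<open>
  Chebyshev's inequality for the scalar product with \<open>\<mu>\<close>, whose mean is \<open>\<epsilon> m\<^sup>2\<close> and whose variance is at
  most \<open>(m\<^sup>2 + \<epsilon> m\<^sup>4) / n\<close>, where \<open>m\<close> is the norm of \<open>\<mu>\<close>. The two terms of the bound come from the
  Gaussian noise and from the random number of shifted observations.
\<close>

lemma prob_inner_sample_mean_small:
  "\<P>(A in (\<Pi>\<^sub>M i\<in>{..<n}. mixture_law d \<epsilon> \<mu>). inner_d d (sample_mean n A) \<mu> \<le> \<epsilon> * (norm_d d \<mu>)\<^sup>2 / 2)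
    \<le> 4 / (real n * (\<epsilon> * norm_d d \<mu>)\<^sup>2) + 4 / (real n * \<epsilon>)"
proof -
  let ?P = "mixture_law d \<epsilon> \<mu>"
  let ?Q = "\<Pi>\<^sub>M i\<in>{..<n}. ?P"
  let ?m = "norm_d d \<mu>"
  let ?h = "\<lambda>x. inner_d d x \<mu>"
  interpret Q: prob_space ?Q by (rule prob_space_mixture_sample)
  define f where "f A = inner_d d (sample_mean n A) \<mu>" for A
  have P: "prob_space ?P" using \<epsilon> by (intro prob_space_mixture_law) auto
  have \<epsilon>': "0 \<le> \<epsilon>" "\<epsilon> \<le> 1" using \<epsilon> by auto
  note h1 = integrable_inner_d_mixture_law[OF \<epsilon>' \<mu>] and h2 = integrable_inner_d_power2_mixture_law[OF \<epsilon>' \<mu>]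
  have f: "f A = (\<Sum>i<n. ?h (A i)) / real n" for A
    unfolding f_def inner_d_def sample_mean_def
    by (subst sum.swap) (simp add: sum_distrib_right sum_divide_distrib)
  have f2: "(f A)\<^sup>2 = (\<Sum>i<n. ?h (A i))\<^sup>2 / (real n)\<^sup>2" for A
    by (simp add: f power_divide)
  have int2: "integrable ?Q (\<lambda>A. (f A)\<^sup>2)" unfolding f2
    by (intro Bochner_Integration.integrable_divide integrable_iid_sum_power2[OF P h1 h2])
  have int1: "integrable ?Q f" unfolding f
    by (intro Bochner_Integration.integrable_divide integrable_iid_sum[OF P h1 h2])
  have E1: "Q.expectation f = \<epsilon> * ?m\<^sup>2"
    unfolding f using n by (simp add: expectation_iid_sum[OF P h1 h2] expectation_inner_d_mixture_law[OF \<epsilon>' \<mu>] inner_d_self)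
  have E2: "Q.expectation (\<lambda>A. (f A)\<^sup>2) = (\<epsilon> * ?m\<^sup>2)\<^sup>2 + (?m\<^sup>2 + \<epsilon> * (?m\<^sup>2)\<^sup>2 - (\<epsilon> * ?m\<^sup>2)\<^sup>2) / real n"
    unfolding f2 using n
    by (simp add: expectation_iid_sum_power2[OF P h1 h2] expectation_inner_d_mixture_law[OF \<epsilon>' \<mu>]
        expectation_inner_d_power2_mixture_law[OF \<epsilon>' \<mu>] inner_d_self add_divide_distrib power_mult_distrib)
       (simp add: power2_eq_square)
  have V: "Q.variance f \<le> (?m\<^sup>2 + \<epsilon> * (?m\<^sup>2)\<^sup>2) / real n"
    by (subst Q.variance_eq[OF int1 int2], unfold E1 E2) (simp add: divide_right_mono)
  have [measurable]: "f \<in> borel_measurable ?Q" unfolding f_def by measurable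
  have a: "0 < \<epsilon> * ?m\<^sup>2 / 2" using \<epsilon> \<mu> by simp
  have "Q.prob {A \<in> space ?Q. f A \<le> \<epsilon> * ?m\<^sup>2 / 2} \<le> Q.prob {A \<in> space ?Q. \<epsilon> * ?m\<^sup>2 / 2 \<le> \<bar>f A - Q.expectation f\<bar>}"
  proof (rule Q.finite_measure_mono)
    have "\<epsilon> * ?m\<^sup>2 / 2 \<le> \<bar>f A - \<epsilon> * ?m\<^sup>2\<bar>" if "f A \<le> \<epsilon> * ?m\<^sup>2 / 2" for A
      using that abs_ge_minus_self[of "f A - \<epsilon> * ?m\<^sup>2"] by argo
    then show "{A \<in> space ?Q. f A \<le> \<epsilon> * ?m\<^sup>2 / 2} \<subseteq> {A \<in> space ?Q. \<epsilon> * ?m\<^sup>2 / 2 \<le> \<bar>f A - Q.expectation f\<bar>}"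
      unfolding E1 by blast
  qed measurable
  also have "\<dots> \<le> Q.variance f / (\<epsilon> * ?m\<^sup>2 / 2)\<^sup>2"
    by (rule Q.Chebyshev_inequality[OF _ int2 a]) measurable
  also have "\<dots> \<le> ((?m\<^sup>2 + \<epsilon> * (?m\<^sup>2)\<^sup>2) / real n) / (\<epsilon> * ?m\<^sup>2 / 2)\<^sup>2"
    by (rule divide_right_mono[OF V]) simp
  also have "\<dots> = 4 / (real n * (\<epsilon> * ?m)\<^sup>2) + 4 / (real n * \<epsilon>)"
    using \<epsilon> \<mu> n by (simp add: field_simps power2_eq_square)
  finally show ?thesis unfolding f_def .
qed

text \<open>
  Markov's inequality, the expected squared norm being computed coordinate by coordinate.
\<close>

lemma prob_norm_sample_mean_large:
  assumes n\<epsilon>: "1 \<le> real n * \<epsilon>" and K: "0 < K"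
  shows "\<P>(A in (\<Pi>\<^sub>M i\<in>{..<n}. mixture_law d \<epsilon> \<mu>).
      K * (real d / real n + 2 * (\<epsilon> * norm_d d \<mu>)\<^sup>2) \<le> (norm_d d (sample_mean n A))\<^sup>2) \<le> 1 / K"
proof -
  let ?P = "mixture_law d \<epsilon> \<mu>"
  let ?Q = "\<Pi>\<^sub>M i\<in>{..<n}. ?P"
  let ?m = "norm_d d \<mu>"
  let ?V = "real d / real n + 2 * (\<epsilon> * ?m)\<^sup>2"
  interpret Q: prob_space ?Q by (rule prob_space_mixture_sample)
  have P: "prob_space ?P" using \<epsilon> by (intro prob_space_mixture_law) auto
  have \<epsilon>': "0 \<le> \<epsilon>" "\<epsilon> \<le> 1" using \<epsilon> by auto
  have coord: "integrable ?Q (\<lambda>A. (sample_mean n A j)\<^sup>2) \<and>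
      Q.expectation (\<lambda>A. (sample_mean n A j)\<^sup>2) \<le> 1 / real n + 2 * (\<epsilon> * \<mu> j)\<^sup>2" if j: "j < d" for j
  proof -
    let ?e = "unit_vec j"
    have in_e: "inner_d d x ?e = x j" for x using j by (rule inner_d_unit_vec)
    have ne: "norm_d d ?e = 1" using j by (rule norm_d_unit_vec)
    then have e0: "norm_d d ?e \<noteq> 0" by simp
    note h1 = integrable_inner_d_mixture_law[OF \<epsilon>' e0, of \<mu>] and h2 = integrable_inner_d_power2_mixture_law[OF \<epsilon>' e0, of \<mu>]
    have f2: "(sample_mean n A j)\<^sup>2 = (\<Sum>i<n. A i j)\<^sup>2 / (real n)\<^sup>2" for A
      by (simp add: sample_mean_def power_divide)
    note moment = expectation_iid_sum_power2[OF P h1 h2, of n,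
        unfolded expectation_inner_d_mixture_law[OF \<epsilon>' e0] expectation_inner_d_power2_mixture_law[OF \<epsilon>' e0], unfolded ne in_e]
    have int: "integrable ?Q (\<lambda>A. (sample_mean n A j)\<^sup>2)" unfolding f2
      by (intro Bochner_Integration.integrable_divide integrable_iid_sum_power2[OF P h1 h2, unfolded in_e])
    have "Q.expectation (\<lambda>A. (sample_mean n A j)\<^sup>2)
        = (1 + \<epsilon> * (\<mu> j)\<^sup>2 - (\<epsilon> * \<mu> j)\<^sup>2) / real n + (\<epsilon> * \<mu> j)\<^sup>2"
      unfolding f2 using n
      by (simp add: moment add_divide_distrib power_mult_distrib)
         (simp add: power2_eq_square)
    also have "\<dots> \<le> (1 + \<epsilon> * (\<mu> j)\<^sup>2) / real n + (\<epsilon> * \<mu> j)\<^sup>2"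
      by (intro add_right_mono divide_right_mono) auto
    \<comment> \<open>The fluctuation of the number of shifted observations contributes \<open>\<epsilon> (\<mu> j)\<^sup>2 / n\<close>; as \<open>n \<epsilon> \<ge> 1\<close>, it
      is dominated by the squared mean and merely doubles it.\<close>
    also have "\<epsilon> * (\<mu> j)\<^sup>2 \<le> real n * \<epsilon> * (\<epsilon> * (\<mu> j)\<^sup>2)"
      using mult_right_mono[OF n\<epsilon>, of "\<epsilon> * (\<mu> j)\<^sup>2"] \<epsilon> by simp
    then have "(1 + \<epsilon> * (\<mu> j)\<^sup>2) / real n + (\<epsilon> * \<mu> j)\<^sup>2
        \<le> (1 + real n * \<epsilon> * (\<epsilon> * (\<mu> j)\<^sup>2)) / real n + (\<epsilon> * \<mu> j)\<^sup>2"
      by (intro add_right_mono divide_right_mono add_left_mono) auto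
    also have "\<dots> = 1 / real n + 2 * (\<epsilon> * \<mu> j)\<^sup>2"
      using n by (simp add: field_simps power2_eq_square)
    finally show ?thesis using int by simp
  qed
  have int: "integrable ?Q (\<lambda>A. (norm_d d (sample_mean n A))\<^sup>2)"
    unfolding norm_d_power2 using coord by (intro Bochner_Integration.integrable_sum) auto
  have "Q.expectation (\<lambda>A. (norm_d d (sample_mean n A))\<^sup>2)
      = (\<Sum>j<d. Q.expectation (\<lambda>A. (sample_mean n A j)\<^sup>2))"
    unfolding norm_d_power2 using coord by (intro Bochner_Integration.integral_sum) auto
  also have "\<dots> \<le> (\<Sum>j<d. 1 / real n + 2 * (\<epsilon> * \<mu> j)\<^sup>2)"
    using coord by (intro sum_mono) auto
  also have "\<dots> = ?V"
    by (simp add: sum.distrib norm_d_power2 power_mult_distrib sum_distrib_left)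
  finally have E: "Q.expectation (\<lambda>A. (norm_d d (sample_mean n A))\<^sup>2) \<le> ?V" .
  have V: "0 < ?V" using \<epsilon> \<mu> by (intro add_nonneg_pos) auto
  have "\<P>(A in ?Q. K * ?V \<le> (norm_d d (sample_mean n A))\<^sup>2)
      \<le> Q.expectation (\<lambda>A. (norm_d d (sample_mean n A))\<^sup>2) / (K * ?V)"
    using K V by (intro integral_Markov_inequality_measure[OF int sets.empty_sets]) auto
  also have "\<dots> \<le> ?V / (K * ?V)" using E K V by (intro divide_right_mono) auto
  also have "\<dots> = 1 / K" using V by simp
  finally show ?thesis .
qed

text \<open>
  The lower bound for the scalar product with \<open>\<mu>\<close> divided by the upper bound for the norm; \<open>a\<close> is their
  quotient, so every remaining dependence on the dimension is contained in \<open>a\<close>.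
\<close>

lemma direction_correlated:
  assumes n\<epsilon>: "1 \<le> real n * \<epsilon>" and K: "0 < K"
  defines "a \<equiv> \<epsilon> * (norm_d d \<mu>)\<^sup>2 / (2 * sqrt (K * (real d / real n + 2 * (\<epsilon> * norm_d d \<mu>)\<^sup>2)))"
  obtains E where "E \<in> sets (\<Pi>\<^sub>M i\<in>{..<n}. mixture_law d \<epsilon> \<mu>)"
    "measure (\<Pi>\<^sub>M i\<in>{..<n}. mixture_law d \<epsilon> \<mu>) (space (\<Pi>\<^sub>M i\<in>{..<n}. mixture_law d \<epsilon> \<mu>) - E)
      \<le> 4 / (real n * (\<epsilon> * norm_d d \<mu>)\<^sup>2) + 4 / (real n * \<epsilon>) + 1 / K"
    "\<And>A. A \<in> E \<Longrightarrow> norm_d d (direction n d A) = 1 \<and> a \<le> inner_d d \<mu> (direction n d A)"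
proof
  let ?Q = "\<Pi>\<^sub>M i\<in>{..<n}. mixture_law d \<epsilon> \<mu>"
  let ?m = "norm_d d \<mu>"
  let ?V = "real d / real n + 2 * (\<epsilon> * ?m)\<^sup>2"
  interpret Q: prob_space ?Q by (rule prob_space_mixture_sample)
  let ?B1 = "{A \<in> space ?Q. inner_d d (sample_mean n A) \<mu> \<le> \<epsilon> * ?m\<^sup>2 / 2}"
  let ?B2 = "{A \<in> space ?Q. K * ?V \<le> (norm_d d (sample_mean n A))\<^sup>2}"
  let ?E = "space ?Q - (?B1 \<union> ?B2)"
  have [measurable]: "?B1 \<in> sets ?Q" "?B2 \<in> sets ?Q" by measurable
  show "?E \<in> sets ?Q" by measurable
  have "space ?Q - ?E = ?B1 \<union> ?B2" by auto
  then have "Q.prob (space ?Q - ?E) \<le> Q.prob ?B1 + Q.prob ?B2"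
    using measure_Un_le[of ?B1 ?Q ?B2] by simp
  then show "Q.prob (space ?Q - ?E) \<le> 4 / (real n * (\<epsilon> * ?m)\<^sup>2) + 4 / (real n * \<epsilon>) + 1 / K"
    using prob_inner_sample_mean_small prob_norm_sample_mean_large[OF n\<epsilon> K] by linarith
  fix A assume "A \<in> ?E"
  then have in_gt: "\<epsilon> * ?m\<^sup>2 / 2 < inner_d d (sample_mean n A) \<mu>"
    and norm_lt: "(norm_d d (sample_mean n A))\<^sup>2 < K * ?V" by auto
  have pos: "0 < \<epsilon> * ?m\<^sup>2 / 2" using \<epsilon> \<mu> by simp
  have ne: "norm_d d (sample_mean n A) \<noteq> 0"
  proof
    assume "norm_d d (sample_mean n A) = 0"
    then have "inner_d d (sample_mean n A) \<mu> = 0"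
      unfolding inner_d_def by (intro sum.neutral) (auto dest: norm_d_eq_0_imp)
    with in_gt pos show False by simp
  qed
  then have npos: "0 < norm_d d (sample_mean n A)" using norm_d_nonneg[of d "sample_mean n A"] by linarith
  have "norm_d d (sample_mean n A) \<le> sqrt (K * ?V)"
    using norm_lt by (intro real_le_rsqrt) simp
  then have "\<epsilon> * ?m\<^sup>2 / 2 / sqrt (K * ?V) \<le> inner_d d (sample_mean n A) \<mu> / norm_d d (sample_mean n A)"
    using in_gt pos npos by (intro frac_le) auto
  then show "norm_d d (direction n d A) = 1 \<and> a \<le> inner_d d \<mu> (direction n d A)"
    using norm_direction[OF ne] by (simp add: inner_direction a_def)
qed

end

definition std_normal_tail :: "real \<Rightarrow> real" where
  "std_normal_tail t = measure std_normal_distribution {t<..}"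

lemma std_normal_tail_antimono: "s \<le> t \<Longrightarrow> std_normal_tail t \<le> std_normal_tail s"
proof -
  interpret real_distribution std_normal_distribution by (rule real_dist_normal_dist)
  show "s \<le> t \<Longrightarrow> std_normal_tail t \<le> std_normal_tail s"
    unfolding std_normal_tail_def by (intro finite_measure_mono) auto
qed

lemma std_normal_tail_eq: "std_normal_tail t = 1 - cdf std_normal_distribution t"
proof -
  interpret real_distribution std_normal_distribution by (rule real_dist_normal_dist)
  have "{t<..} = space std_normal_distribution - {..t}" by auto
  then show ?thesis
    unfolding std_normal_tail_def cdf_def using prob_compl[of "{..t}"] by simp
qed

text \<open>
  Shifting the threshold to the left increases the tail at least linearly, as long as both thresholds
  stay in a fixed compact set.
\<close>

lemma std_normal_tail_diff:
  assumes "-T \<le> s" "s \<le> t" "t \<le> T"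
  shows "std_normal_tail t + std_normal_density T * (t - s) \<le> std_normal_tail s"
proof (cases "s = t")
  case False
  interpret real_distribution std_normal_distribution by (rule real_dist_normal_dist)
  have "std_normal_tail s - std_normal_tail t = measure std_normal_distribution {s<..t}"
    using cdf_diff_eq[of s t] assms False by (simp add: std_normal_tail_eq)
  then show ?thesis using std_normal_interval_ge[OF assms] by simp
qed simp

lemma measure_gauss_law_halfspace:
  assumes v: "norm_d d v = 1"
  shows "measure (gauss_law d \<mu>) {x \<in> space (PiM {..<d} (\<lambda>_. borel)). t < inner_d d x v} = std_normal_tail (t - inner_d d \<mu> v)"
proof -
  interpret prob_space "gauss_law d \<mu>" by (rule prob_space_gauss_law)
  let ?a = "inner_d d \<mu> v"
  have sp: "space (gauss_law d \<mu>) = space (PiM {..<d} (\<lambda>_. borel))"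
    by (rule sets_eq_imp_space_eq) (rule sets_gauss_law)
  have "distributed (gauss_law d \<mu>) lborel (\<lambda>x. inner_d d x v) (normal_density ?a 1)"
    using distributed_inner_d_gauss_law[of d v \<mu>] v by simp
  then have "distributed (gauss_law d \<mu>) lborel (\<lambda>x. (inner_d d x v - ?a) / 1) std_normal_density"
    by (subst (asm) normal_standard_normal_convert) auto
  then have "distr (gauss_law d \<mu>) lborel (\<lambda>x. (inner_d d x v - ?a) / 1) = std_normal_distribution"
    by (rule distributed_distr_eq_density)
  then have "std_normal_tail (t - ?a) = measure (distr (gauss_law d \<mu>) lborel (\<lambda>x. (inner_d d x v - ?a) / 1)) {t - ?a<..}"
    by (simp add: std_normal_tail_def)
  also have "\<dots> = prob ((\<lambda>x. (inner_d d x v - ?a) / 1) -` {t - ?a<..} \<inter> space (gauss_law d \<mu>))"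
    by (rule measure_distr) auto
  also have "\<dots> = prob {x \<in> space (PiM {..<d} (\<lambda>_. borel)). t < inner_d d x v}"
    unfolding sp by (intro arg_cong[where f=prob]) auto
  finally show ?thesis ..
qed

text \<open>
  As the expected number of exceedances of \<open>t\<close> is at most \<open>k - s\<close>, having \<open>k\<close> of them is a
  deviation by at least \<open>s\<close>, whose probability is at most \<open>u\<close> by Hoeffding's inequality.
\<close>

lemma order_quantile_le_of_tail:
  assumes k: "1 \<le> k" "k \<le> n" and u: "0 < u" "u < 1" and s: "0 \<le> s"
    and t: "real n * std_normal_tail t + s \<le> real k" and exp: "exp (- 2 * s\<^sup>2 / real n) \<le> u"
  shows "order_quantile n u k \<le> t"
proof (rule order_quantile_le[OF k u])
  interpret prob_space "gauss_sample n" by (rule prob_space_gauss_sample)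
  have "\<P>(z in gauss_sample n. t < order_stat n z (n - k + 1))
      \<le> \<P>(z in gauss_sample n. real n * std_normal_tail t + s \<le> real (card {i. i < n \<and> z i \<in> {t<..}}))"
  proof (rule finite_measure_mono)
    show "{z \<in> space (gauss_sample n). t < order_stat n z (n - k + 1)}
        \<subseteq> {z \<in> space (gauss_sample n). real n * std_normal_tail t + s \<le> real (card {i. i < n \<and> z i \<in> {t<..}})}"
      unfolding order_stat_gt_iff[OF k] using t by auto
    show "{z \<in> space (gauss_sample n). real n * std_normal_tail t + s \<le> real (card {i. i < n \<and> z i \<in> {t<..}})} \<in> events"
      unfolding card_eq_sum_indicator by measurable
  qed
  also have "\<dots> \<le> exp (- 2 * s\<^sup>2 / real n)"
    unfolding gauss_sample_def std_normal_tail_def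
    using k s prob_space_normal_density[of 1 0] by (intro prob_count_ge) auto
  also note exp
  finally show "\<P>(z in gauss_sample n. t < order_stat n z (n - k + 1)) \<le> u" .
qed

text \<open>
  Acceptance means, already at the index \<open>k\<close>, that fewer than \<open>k\<close> projections exceed \<open>t\<close>, although
  at least \<open>k + r\<close> are expected to.
\<close>

lemma Psi2_conditional_type_II:
  assumes n: "2 \<le> n" and k: "k \<in> K_set n" and \<epsilon>: "0 < \<epsilon>" "\<epsilon> < 1"
    and q: "order_quantile n (alpha_n n \<alpha>) k \<le> t"
    and v: "norm_d d (direction n d A) = 1" and r: "0 \<le> r"
    and gap: "real k + r \<le> real n * ((1 - \<epsilon>) * std_normal_tail t
        + \<epsilon> * std_normal_tail (t - inner_d d \<mu> (direction n d A)))"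
  shows "\<P>(y in (\<Pi>\<^sub>M i\<in>{..<n}. mixture_law d \<epsilon> \<mu>). Psi2 \<alpha> n d (A, y) = 0) \<le> exp (- 2 * r\<^sup>2 / real n)"
proof -
  let ?P = "mixture_law d \<epsilon> \<mu>"
  let ?Q = "\<Pi>\<^sub>M i\<in>{..<n}. ?P"
  let ?v = "direction n d A"
  let ?B = "{x \<in> space (PiM {..<d} (\<lambda>_. borel)). t < inner_d d x ?v}"
  have P: "prob_space ?P" using \<epsilon> by (intro prob_space_mixture_law) auto
  interpret Q: prob_space ?Q by (intro prob_space_PiM P)
  have B: "?B \<in> sets (PiM {..<d} (\<lambda>_. borel))" by measurable
  then have BP [measurable]: "?B \<in> sets ?P" by (simp add: sets_mixture_law)
  have "inner_d d (\<lambda>_. 0) ?v = 0" by (simp add: inner_d_def)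
  then have PB: "measure ?P ?B = (1 - \<epsilon>) * std_normal_tail t + \<epsilon> * std_normal_tail (t - inner_d d \<mu> ?v)"
    using \<epsilon> B by (simp add: measure_mixture_law measure_gauss_law_halfspace[OF v])
  note kb = K_set_bounds[OF n k]
  have "\<P>(y in ?Q. Psi2 \<alpha> n d (A, y) = 0)
      \<le> \<P>(y in ?Q. real (card {i. i < n \<and> y i \<in> ?B}) \<le> real n * measure ?P ?B - r)"
  proof (rule Q.finite_measure_mono)
    show "{y \<in> space ?Q. Psi2 \<alpha> n d (A, y) = 0} \<subseteq>
        {y \<in> space ?Q. real (card {i. i < n \<and> y i \<in> ?B}) \<le> real n * measure ?P ?B - r}"
    proof
      fix y assume "y \<in> {y \<in> space ?Q. Psi2 \<alpha> n d (A, y) = 0}"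
      then have y: "y \<in> space ?Q" and "Psi2 \<alpha> n d (A, y) = 0" by auto
      then have "\<not> order_quantile n (alpha_n n \<alpha>) k < order_stat n (projected n d (A, y)) (n - k + 1)"
        unfolding Psi2_eq_of_bool[OF n] using k by auto
      then have "card {i. i < n \<and> order_quantile n (alpha_n n \<alpha>) k < projected n d (A, y) i} < k"
        unfolding order_stat_gt_iff[OF kb(1,3)] by simp
      moreover have "card {i. i < n \<and> y i \<in> ?B}
          \<le> card {i. i < n \<and> order_quantile n (alpha_n n \<alpha>) k < projected n d (A, y) i}"
        using q by (intro card_mono) (auto simp: projected_def)
      ultimately have "real (card {i. i < n \<and> y i \<in> ?B}) \<le> real k" by linarith
      with y gap show "y \<in> {y \<in> space ?Q. real (card {i. i < n \<and> y i \<in> ?B}) \<le> real n * measure ?P ?B - r}"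
        by (simp add: PB)
    qed
    show "{y \<in> space ?Q. real (card {i. i < n \<and> y i \<in> ?B}) \<le> real n * measure ?P ?B - r} \<in> Q.events"
      unfolding card_eq_sum_indicator by measurable
  qed
  also have "\<dots> \<le> exp (- 2 * r\<^sup>2 / real n)"
    using n r by (intro prob_count_le P BP) auto
  finally show ?thesis .
qed

text \<open>
  Off the event where the estimated direction is poor, the component of \<open>\<mu>\<close> along it is at least \<open>a\<close>
  and \<open>a \<le> M\<close>. The expected number of exceedances of \<open>t\<close> then grows by at least
  \<open>n \<epsilon> a std_normal_density (T + M)\<close>, because \<open>t - a\<close> and \<open>t\<close> lie in \<open>[-(T + M), T + M]\<close>; this has to
  pay for the deviation \<open>s\<close> under the null hypothesis and for \<open>r\<close> under the alternative.
\<close>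

lemma Psi2_type_II_bound:
  assumes n: "2 \<le> n" and k: "k \<in> K_set n" and \<alpha>: "0 < \<alpha>" "\<alpha> < 1"
    and \<epsilon>: "0 < \<epsilon>" "\<epsilon> < 1" and \<mu>: "0 < norm_d d \<mu>" "norm_d d \<mu> \<le> M"
    and n\<epsilon>: "1 \<le> real n * \<epsilon>" and K: "1 \<le> K"
    and s: "0 \<le> s" and r: "0 \<le> r"
    and t: "real n * std_normal_tail t + s = real k" "\<bar>t\<bar> \<le> T"
    and s_large: "exp (- 2 * s\<^sup>2 / real n) \<le> alpha_n n \<alpha>"
  defines "a \<equiv> \<epsilon> * (norm_d d \<mu>)\<^sup>2 / (2 * sqrt (K * (real d / real n + 2 * (\<epsilon> * norm_d d \<mu>)\<^sup>2)))"
  assumes gap: "s + r \<le> real n * \<epsilon> * a * std_normal_density (T + M)"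
  shows "\<P>(x in sample_law n d (mixture_density d \<epsilon> \<mu>). Psi2 \<alpha> n d x = 0)
    \<le> 4 / (real n * (\<epsilon> * norm_d d \<mu>)\<^sup>2) + 4 / (real n * \<epsilon>) + 1 / K + exp (- 2 * r\<^sup>2 / real n)"
proof -
  let ?P = "mixture_law d \<epsilon> \<mu>"
  let ?Q = "\<Pi>\<^sub>M i\<in>{..<n}. ?P"
  let ?m = "norm_d d \<mu>"
  let ?b = "4 / (real n * (\<epsilon> * ?m)\<^sup>2) + 4 / (real n * \<epsilon>) + 1 / K"
  note kb = K_set_bounds[OF n k]
  have pQ: "prob_space ?Q" using \<epsilon> by (intro prob_space_PiM prob_space_mixture_law) auto
  have "0 < n" "norm_d d \<mu> \<noteq> 0" "0 < K" using n \<mu> K by auto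
  from direction_correlated[OF this(1) \<epsilon> this(2) n\<epsilon> this(3), folded a_def]
  obtain E where E: "E \<in> sets ?Q" "measure ?Q (space ?Q - E) \<le> ?b"
    "\<And>A. A \<in> E \<Longrightarrow> norm_d d (direction n d A) = 1 \<and> a \<le> inner_d d \<mu> (direction n d A)"
    by blast
  have au: "0 < alpha_n n \<alpha>" "alpha_n n \<alpha> < 1"
    using alpha_n_pos[OF n \<alpha>] alpha_n_le[OF n \<alpha>] \<alpha> by auto
  have q: "order_quantile n (alpha_n n \<alpha>) k \<le> t"
    using t(1) by (intro order_quantile_le_of_tail[OF kb(1,3) au s _ s_large]) simp
  have "0 < \<epsilon> * ?m" using \<epsilon> \<mu> by simp
  have a0: "0 \<le> a" unfolding a_def using \<epsilon> K
    by (intro divide_nonneg_nonneg mult_nonneg_nonneg real_sqrt_ge_zero add_nonneg_nonneg) auto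
  have "a \<le> ?m"
  proof -
    have "1 * (\<epsilon> * ?m)\<^sup>2 \<le> K * (real d / real n + 2 * (\<epsilon> * ?m)\<^sup>2)"
      using K by (intro mult_mono) auto
    then have "\<epsilon> * ?m \<le> sqrt (K * (real d / real n + 2 * (\<epsilon> * ?m)\<^sup>2))" (is "_ \<le> ?H")
      by (intro real_le_rsqrt) simp
    with \<open>0 < \<epsilon> * ?m\<close> have H: "\<epsilon> * ?m \<le> 2 * ?H" "0 < 2 * ?H" by linarith+
    then have "a \<le> \<epsilon> * ?m\<^sup>2 / (\<epsilon> * ?m)"
      unfolding a_def using \<open>0 < \<epsilon> * ?m\<close> \<epsilon> \<mu>(1) by (intro divide_left_mono mult_pos_pos) auto
    also have "\<dots> = ?m" using \<epsilon> \<mu> by (simp add: power2_eq_square)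
    finally show ?thesis .
  qed
  with \<mu> have aM: "a \<le> M" by simp
  have shift: "std_normal_tail t + std_normal_density (T + M) * a \<le> std_normal_tail (t - a)"
    using std_normal_tail_diff[of "T + M" "t - a" t] a0 aM t(2) by auto
  have meas: "Psi2 \<alpha> n d \<in> ?Q \<Otimes>\<^sub>M ?Q \<rightarrow>\<^sub>M count_space UNIV"
    by (rule Psi2_measurable[OF n sets_mixture_law])
  have S: "{x \<in> space (?Q \<Otimes>\<^sub>M ?Q). Psi2 \<alpha> n d x = 0} \<in> sets (?Q \<Otimes>\<^sub>M ?Q)"
    using measurable_sets[OF meas, of "{0}"]
    by (simp add: vimage_def Int_def conj_commute)
  have "measure (?Q \<Otimes>\<^sub>M ?Q) {x \<in> space (?Q \<Otimes>\<^sub>M ?Q). Psi2 \<alpha> n d x = 0} \<le> ?b + exp (- 2 * r\<^sup>2 / real n)"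
  proof (rule measure_pair_measure_le[OF pQ pQ E(1) S E(2)])
    fix A assume A: "A \<in> E"
    let ?v = "direction n d A"
    have v: "norm_d d ?v = 1" and av: "a \<le> inner_d d \<mu> ?v" using E(3)[OF A] by auto
    have "real k + r \<le> real n * std_normal_tail t + real n * \<epsilon> * a * std_normal_density (T + M)"
      using t(1) gap by linarith
    also have "\<dots> = real n * ((1 - \<epsilon>) * std_normal_tail t
        + \<epsilon> * (std_normal_tail t + std_normal_density (T + M) * a))"
      by (simp add: algebra_simps)
    also have "\<dots> \<le> real n * ((1 - \<epsilon>) * std_normal_tail t + \<epsilon> * std_normal_tail (t - inner_d d \<mu> ?v))"
      using order_trans[OF shift std_normal_tail_antimono[of "t - inner_d d \<mu> ?v" "t - a"]] av \<epsilon>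
      by (intro mult_left_mono add_left_mono) auto
    finally have "\<P>(y in ?Q. Psi2 \<alpha> n d (A, y) = 0) \<le> exp (- 2 * r\<^sup>2 / real n)"
      by (rule Psi2_conditional_type_II[OF n k \<epsilon> q v r])
    moreover have "{y \<in> space ?Q. (A, y) \<in> {x \<in> space (?Q \<Otimes>\<^sub>M ?Q). Psi2 \<alpha> n d x = 0}}
        = {y \<in> space ?Q. Psi2 \<alpha> n d (A, y) = 0}"
      using sets.sets_into_space[OF E(1)] A by (auto simp: space_pair_measure)
    ultimately show "measure ?Q {y \<in> space ?Q. (A, y) \<in> {x \<in> space (?Q \<Otimes>\<^sub>M ?Q). Psi2 \<alpha> n d x = 0}}
        \<le> exp (- 2 * r\<^sup>2 / real n)"
      by simp
  qed simp
  then show ?thesis unfolding sample_law_mixture .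
qed

section \<open>The choice of the constant\<close>

text \<open>
  Consequently \<open>ln (ln n)\<close> is bounded below by a positive constant for \<open>n \<ge> 3\<close>, so that any additive
  constant can be absorbed into a multiple of it.
\<close>

lemma one_less_ln_3: "1 < ln (3::real)"
proof -
  have "exp (1 / 4) \<le> 1 + 1 / 4 + (1 / 4 :: real)\<^sup>2" by (rule exp_bound) auto
  then have "exp (1 / 4) ^ 4 \<le> (21 / 16 :: real) ^ 4" by (intro power_mono) (auto simp: power2_eq_square)
  moreover have "exp (1 / 4 :: real) ^ 4 = exp 1" by (simp flip: exp_of_nat_mult)
  ultimately have "exp 1 < (3::real)" by (simp add: power4_eq_xxxx)
  then show ?thesis using ln_less_cancel_iff[of "exp 1" "3 :: real"] by simp
qed

text \<open>
  Intermediate values for the continuous tail function; \<open>T\<close> is uniform in \<open>p\<close>.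
\<close>

lemma exists_std_normal_tail:
  assumes "0 < p1" "p0 < 1"
  obtains T where "\<And>p. p1 \<le> p \<Longrightarrow> p \<le> p0 \<Longrightarrow> \<exists>t. std_normal_tail t = p \<and> \<bar>t\<bar> \<le> T"
proof -
  interpret real_distribution std_normal_distribution by (rule real_dist_normal_dist)
  have cont: "continuous_on A std_normal_tail" for A
    unfolding std_normal_tail_eq[abs_def]
    by (intro continuous_intros continuous_at_imp_continuous_on) (auto simp: isCont_cdf std_normal_no_atoms)
  have "eventually (\<lambda>t. 1 - p1 < cdf std_normal_distribution t) at_top"
    using cdf_lim_at_top_prob by (rule order_tendstoD) (use assms in auto)
  then obtain b where b: "\<And>t. b \<le> t \<Longrightarrow> std_normal_tail t < p1"
    by (force simp: eventually_at_top_linorder std_normal_tail_eq)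
  have "eventually (\<lambda>t. cdf std_normal_distribution t < 1 - p0) at_bot"
    using cdf_lim_at_bot by (rule order_tendstoD) (use assms in auto)
  then obtain a where "\<forall>t\<le>a. cdf std_normal_distribution t < 1 - p0"
    by (auto simp: eventually_at_bot_linorder)
  then have a: "p0 < std_normal_tail t" if "t \<le> a" for t
    using that by (force simp: std_normal_tail_eq)
  let ?T = "max \<bar>a\<bar> \<bar>b\<bar>"
  have "\<exists>t. std_normal_tail t = p \<and> \<bar>t\<bar> \<le> ?T" if "p1 \<le> p" "p \<le> p0" for p
  proof -
    have "\<exists>t\<ge>- ?T. t \<le> ?T \<and> std_normal_tail t = p"
    proof (rule IVT2'[OF _ _ _ cont])
      have "- ?T \<le> a" "b \<le> ?T" by linarith+
      from a[OF this(1)] b[OF this(2)] that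
      show "std_normal_tail ?T \<le> p" "p \<le> std_normal_tail (- ?T)" by linarith+
    qed linarith
    then show ?thesis by (auto simp: abs_le_iff)
  qed
  then show ?thesis by (rule that)
qed

lemma null_log_constant_nonneg:
  assumes "0 < \<alpha>" "\<alpha> < 1"
  shows "0 \<le> ln (1 / \<alpha>) - ln (ln (2::real))"
proof -
  have "ln (ln 2) \<le> (0::real)" using ln_2_less_1 by simp
  moreover have "0 \<le> ln (1 / \<alpha>)" using assms by simp
  ultimately show ?thesis by linarith
qed

text \<open>
  The union bound \<open>alpha_n n \<alpha> \<ge> \<alpha> / log\<^sub>2 n = \<alpha> ln 2 / ln n\<close>, with the constant factor absorbed into the
  coefficient of \<open>ln (ln n)\<close> in the exponent. That coefficient is at least 1 as \<open>\<alpha> < 1\<close> and \<open>ln 2 < 1\<close>.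
\<close>

lemma alpha_n_ge_exp:
  assumes n: "3 \<le> n" and \<alpha>: "0 < \<alpha>" "\<alpha> < 1"
  shows "exp (- ((1 + (ln (1 / \<alpha>) - ln (ln 2)) / ln (ln 3)) * ln (ln (real n)))) \<le> alpha_n n \<alpha>"
proof -
  have n2: "2 \<le> n" using n by simp
  have l3: "0 < ln (ln (3::real))" using one_less_ln_3 by simp
  have ln3: "ln 3 \<le> ln (real n)" using n by simp
  have lln: "ln (ln 3) \<le> ln (ln (real n))" using ln3 one_less_ln_3 by simp
  have lpos: "0 < ln (real n)" using ln3 one_less_ln_3 by linarith
  note D = null_log_constant_nonneg[OF \<alpha>]
  have "ln (1 / \<alpha>) - ln (ln 2) \<le> (ln (1 / \<alpha>) - ln (ln 2)) / ln (ln 3) * ln (ln (real n))"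
    using mult_left_mono[OF lln D] l3 by (simp add: field_simps)
  then have "- ((1 + (ln (1 / \<alpha>) - ln (ln 2)) / ln (ln 3)) * ln (ln (real n)))
      \<le> ln \<alpha> + ln (ln 2) - ln (ln (real n))"
    using \<alpha> by (simp add: distrib_right ln_div)
  also have "\<dots> = ln (\<alpha> * ln 2 / ln (real n))" using \<alpha> lpos by (simp add: ln_mult ln_div)
  finally have "exp (- ((1 + (ln (1 / \<alpha>) - ln (ln 2)) / ln (ln 3)) * ln (ln (real n))))
      \<le> exp (ln (\<alpha> * ln 2 / ln (real n)))" by simp
  also have "\<dots> = \<alpha> / log 2 (real n)" using \<alpha> lpos by (simp add: log_def)
  also have "\<dots> \<le> \<alpha> / real (card (K_set n))"
    using \<alpha> card_K_set_le[OF n2] finite_K_set[OF n2] K_set_nonempty[OF n2]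
    by (intro divide_left_mono mult_pos_pos) (auto simp: card_gt_0_iff log_def lpos)
  also have "\<dots> \<le> alpha_n n \<alpha>" by (rule alpha_n_ge[OF n2 \<alpha>])
  finally show ?thesis .
qed

text \<open>
  Here \<open>x = n (\<epsilon> m)\<^sup>2\<close> is the squared signal relative to the noise level \<open>1 / n\<close>. Up to constants the
  projected sample has signal \<open>x / sqrt (d + 2 x)\<close>, and the claim says that this is at least
  \<open>C sqrt (L / 3)\<close>. If \<open>d \<le> x\<close> the estimated direction has a correlation with \<open>\<mu>\<close> bounded from below and the
  signal is at least of order \<open>sqrt x\<close>; if \<open>x < d\<close> the noise dominates, the signal is of order \<open>x / sqrt d\<close>, and it is this regime
  that forces the factor \<open>d\<^sup>1\<^sup>/\<^sup>4\<close> in the separation rate.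
\<close>

lemma signal_bound:
  fixes x d L C :: real
  assumes "1 \<le> d" "1 \<le> C\<^sup>2 * L" and x: "C\<^sup>2 * L * sqrt d \<le> x"
  shows "C\<^sup>2 * L * (d + 2 * x) \<le> 3 * x\<^sup>2"
proof -
  let ?y = "C\<^sup>2 * L"
  have sd: "1 \<le> sqrt d" using assms(1) by simp
  have "?y * 1 \<le> ?y * sqrt d" using sd assms(2) by (intro mult_left_mono) auto
  with x have yx: "?y \<le> x" by simp
  show ?thesis
  proof (cases "d \<le> x")
    case True
    have "?y * (d + 2 * x) \<le> x * (3 * x)"
      using True yx assms by (intro mult_mono) auto
    then show ?thesis by (simp add: power2_eq_square)
  next
    case False
    have "?y * (d + 2 * x) \<le> ?y * (3 * d)" using False assms(2) by (intro mult_left_mono) auto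
    also have "\<dots> = 3 * (1 * ?y * (sqrt d)\<^sup>2)" using assms(1) by simp
    also have "\<dots> \<le> 3 * (?y * ?y * (sqrt d)\<^sup>2)"
      using assms by (intro mult_left_mono mult_right_mono) auto
    also have "\<dots> = 3 * (?y * sqrt d)\<^sup>2" by (simp add: power_mult_distrib power2_eq_square)
    also have "\<dots> \<le> 3 * x\<^sup>2" using x sd assms(2) by (intro mult_left_mono power_mono) auto
    finally show ?thesis .
  qed
qed

text \<open>
  The four error terms of \<open>Psi2_type_II_bound\<close> are made at most \<open>\<beta> / 8\<close>, \<open>\<beta> / 8\<close>, \<open>\<beta> / 4\<close> and
  \<open>\<beta> / 2\<close>. Here \<open>B ln (ln n)\<close> bounds the logarithm of \<open>1 / alpha_n\<close>, \<open>c\<close> is the density bound on the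
  compact set of thresholds, and \<open>G\<close> collects the two Hoeffding deviations in units of
  \<open>sqrt (n ln (ln n))\<close>. As \<open>\<epsilon> < 1\<close>, the condition \<open>n \<epsilon> \<ge> C\<close> also forces \<open>n \<ge> C\<close>, so small sample
  sizes are excluded by the choice of \<open>C\<close>.
\<close>

lemma Psi2_power:
  fixes \<alpha> \<beta> M :: real
  assumes \<alpha>: "0 < \<alpha>" "\<alpha> < 1" and \<beta>: "0 < \<beta>" "\<beta> < 1"
  shows "\<exists>C > 0. \<forall>(d::nat) (n::nat) \<epsilon> \<mu>. d \<ge> 1 \<longrightarrow> n \<ge> 3 \<longrightarrow> 0 < \<epsilon> \<longrightarrow> \<epsilon> < 1 \<longrightarrow> norm_d d \<mu> \<le> M \<longrightarrow>
      C * (real d powr (1 / 4) / sqrt (real n)) * sqrt (ln (ln (real n))) \<le> \<epsilon> * norm_d d \<mu> \<longrightarrow>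
      C \<le> real n * \<epsilon> \<longrightarrow>
      \<P>(s in sample_law n d (mixture_density d \<epsilon> \<mu>). Psi2 \<alpha> n d s = 0) \<le> \<beta>"
proof -
  let ?L = "\<lambda>n::nat. ln (ln (real n))"
  define L0 where "L0 = ln (ln (3::real))"
  define B where "B = 1 + (ln (1 / \<alpha>) - ln (ln 2)) / L0"
  define K where "K = 4 / \<beta>"
  have L0: "0 < L0" using one_less_ln_3 by (simp add: L0_def)
  have B: "1 \<le> B" using null_log_constant_nonneg[OF \<alpha>] L0 by (simp add: B_def)
  have K: "1 \<le> K" using \<beta> by (simp add: K_def)
  have "((\<lambda>n. ln (ln (real n)) / real n) \<longlongrightarrow> 0) sequentially" by real_asymp
  then have "eventually (\<lambda>n. ?L n / real n < 1 / (32 * B)) sequentially"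
    by (rule order_tendstoD) (use B in auto)
  then obtain N0 where "\<And>n. N0 \<le> n \<Longrightarrow> ?L n / real n < 1 / (32 * B)"
    by (auto simp: eventually_sequentially)
  then have N0: "B * ?L n \<le> real n / 32" if "N0 \<le> n" "3 \<le> n" for n
    using that B by (force simp: field_simps)
  obtain T where T: "\<And>p. 1 / 8 \<le> p \<Longrightarrow> p \<le> 1 / 2 \<Longrightarrow> \<exists>t. std_normal_tail t = p \<and> \<bar>t\<bar> \<le> T"
    using exists_std_normal_tail[of "1 / 8" "1 / 2"] by auto
  define c where "c = std_normal_density (T + M)"
  have c: "0 < c" unfolding c_def by (intro normal_density_pos) simp
  define G where "G = sqrt (B / 2) + sqrt (ln (2 / \<beta>) / (2 * L0))"
  have lb: "0 < ln (2 / \<beta>)" using \<beta> by (intro ln_gt_zero) simp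
  have G: "0 \<le> G" using B lb L0 by (auto simp: G_def)
  \<comment> \<open>The summands ensure, in this order: \<open>n \<epsilon> \<ge> 1\<close>; \<open>C\<^sup>2 L \<ge> C\<close> where \<open>L = ln (ln n)\<close>; the bounds for
    Chebyshev's inequality; that \<open>n\<close> is large; and that the shift beats the Hoeffding deviations.\<close>
  define C where "C = 1 + 1 / L0 + 32 / \<beta> + real N0 + 2 * sqrt (3 * K) * G / c"
  have terms: "0 < 1 / L0" "0 < 32 / \<beta>" "0 \<le> 2 * sqrt (3 * K) * G / c"
    using L0 \<beta> K G c by auto
  then have C: "1 \<le> C" "1 / L0 \<le> C" "32 / \<beta> \<le> C" "real N0 \<le> C" "2 * sqrt (3 * K) * G / c \<le> C"
    unfolding C_def by linarith+
  show ?thesis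
  proof (intro exI[of _ C] conjI allI impI)
    show "0 < C" using C by simp
    fix d n :: nat and \<epsilon> :: real and \<mu> :: "nat \<Rightarrow> real"
    assume d: "1 \<le> d" and n: "3 \<le> n" and \<epsilon>: "0 < \<epsilon>" "\<epsilon> < 1" and m_le: "norm_d d \<mu> \<le> M"
      and signal: "C * (real d powr (1 / 4) / sqrt (real n)) * sqrt (?L n) \<le> \<epsilon> * norm_d d \<mu>"
      and n\<epsilon>: "C \<le> real n * \<epsilon>"
    let ?m = "norm_d d \<mu>"
    define L where "L = ?L n"
    have n2: "2 \<le> n" and n0: "0 < real n" using n by auto
    have ln3: "ln 3 \<le> ln (real n)" using n by simp
    then have L: "L0 \<le> L" using one_less_ln_3 by (simp add: L_def L0_def)
    with L0 have Lpos: "0 < L" by simp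
    have "real n * \<epsilon> \<le> real n" using \<epsilon> n0 by simp
    with n\<epsilon> C have "N0 \<le> n" by linarith
    with n N0 have BL: "B * L \<le> real n / 32" by (simp add: L_def)
    have "0 < C * (real d powr (1 / 4) / sqrt (real n)) * sqrt L"
      using C d n0 Lpos by (intro mult_pos_pos divide_pos_pos) auto
    with signal have "0 < \<epsilon> * ?m" by (simp add: L_def)
    with \<epsilon> have m: "0 < ?m" by (simp add: zero_less_mult_iff)
    define x where "x = real n * (\<epsilon> * ?m)\<^sup>2"
    have x: "C\<^sup>2 * L * sqrt (real d) \<le> x"
    proof -
      have "(C * (real d powr (1 / 4) / sqrt (real n)) * sqrt L)\<^sup>2 \<le> (\<epsilon> * ?m)\<^sup>2"
        using signal C d n0 Lpos by (intro power_mono) (auto simp: L_def)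
      moreover have "(real d powr (1 / 4))\<^sup>2 = sqrt (real d)"
        using d by (simp add: powr_power powr_half_sqrt)
      ultimately have "C\<^sup>2 * (sqrt (real d) / real n) * L \<le> (\<epsilon> * ?m)\<^sup>2"
        using n0 Lpos by (simp add: power_mult_distrib power_divide)
      then show ?thesis using n0 by (simp add: x_def field_simps)
    qed
    have C2L: "C \<le> C\<^sup>2 * L"
    proof -
      have "1 \<le> C * L0" using C(2) L0 by (simp add: field_simps)
      also have "\<dots> \<le> C * L" using L C by (intro mult_left_mono) auto
      finally have "C * 1 \<le> C * (C * L)" using C by (intro mult_left_mono) auto
      then show ?thesis by (simp add: power2_eq_square mult.assoc)
    qed
    with C have "1 \<le> C\<^sup>2 * L" by linarith
    then have xd: "C\<^sup>2 * L * (real d + 2 * x) \<le> 3 * x\<^sup>2"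
      using d x by (intro signal_bound) auto
    have "C\<^sup>2 * L * 1 \<le> C\<^sup>2 * L * sqrt (real d)" using d Lpos by (intro mult_left_mono) auto
    with x C2L C have xC: "32 / \<beta> \<le> x" by linarith
    then have xpos: "0 < x" using terms by linarith

    obtain k where k: "k \<in> K_set n" "real n / 4 < real k" by (rule K_set_large_element[OF n2])
    have k_le: "real k \<le> real n / 2" by (rule K_set_bounds[OF n2 k(1)])
    define s where "s = sqrt (real n * (B * L) / 2)"
    define r where "r = sqrt (real n * ln (2 / \<beta>) / 2)"
    have s0: "0 \<le> s" and r0: "0 \<le> r" using B Lpos lb by (auto simp: s_def r_def)
    have s2: "2 * s\<^sup>2 / real n = B * L" using n0 B Lpos by (simp add: s_def)
    have r2: "2 * r\<^sup>2 / real n = ln (2 / \<beta>)" using n0 lb by (simp add: r_def)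
    have "s \<le> sqrt ((real n / 8)\<^sup>2)"
    proof -
      have "real n * (B * L) \<le> real n * (real n / 32)" using BL n0 by (intro mult_left_mono) auto
      then show ?thesis unfolding s_def by (intro real_sqrt_le_mono) (simp add: power2_eq_square mult_ac)
    qed
    \<comment> \<open>The correction \<open>s\<close> is at most \<open>n / 8\<close>, so the tail value that defines \<open>t\<close> stays between 1/8 and
      1/2.\<close>
    then have s8: "s \<le> real n / 8" by simp
    have "1 / 8 \<le> (real k - s) / real n" "(real k - s) / real n \<le> 1 / 2"
      using k(2) k_le s0 s8 n0 by (simp_all add: field_simps)
    from T[OF this] obtain t where t: "std_normal_tail t = (real k - s) / real n" "\<bar>t\<bar> \<le> T" by blast
    have s_large: "exp (- 2 * s\<^sup>2 / real n) \<le> alpha_n n \<alpha>"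
      using alpha_n_ge_exp[OF n \<alpha>] s2 by (simp add: B_def L0_def L_def)
    define H where "H = sqrt (K * (real d / real n + 2 * (\<epsilon> * ?m)\<^sup>2))"
    have H: "0 < H" unfolding H_def using K \<epsilon> m by (intro real_sqrt_gt_zero mult_pos_pos add_nonneg_pos) auto
    have sr: "s + r \<le> sqrt (real n * L) * G"
    proof -
      have "r = sqrt (real n * (L0 * (ln (2 / \<beta>) / (2 * L0))))" using L0 by (simp add: r_def)
      also have "\<dots> \<le> sqrt (real n * (L * (ln (2 / \<beta>) / (2 * L0))))"
        using L L0 lb n0 by (intro real_sqrt_le_mono mult_left_mono mult_right_mono) auto
      finally have "r \<le> sqrt (real n * L) * sqrt (ln (2 / \<beta>) / (2 * L0))"
        by (simp add: real_sqrt_mult[symmetric] mult.assoc)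
      moreover have "s = sqrt (real n * L) * sqrt (B / 2)"
        by (simp add: s_def real_sqrt_mult[symmetric] mult_ac)
      ultimately show ?thesis by (simp add: G_def distrib_left)
    qed
    \<comment> \<open>\<open>H\<close> is the high probability bound for the norm of the sample mean; in squared form this is
      \<open>signal_bound\<close>.\<close>
    have HC: "C * (H * sqrt (real n * L)) \<le> sqrt (3 * K) * x"
    proof (rule power2_le_imp_le)
      have "(C * (H * sqrt (real n * L)))\<^sup>2 = K * (C\<^sup>2 * L * (real d + 2 * x))"
      proof -
        have "H\<^sup>2 = K * (real d / real n + 2 * (\<epsilon> * ?m)\<^sup>2)"
          unfolding H_def using K by simp
        then have "real n * H\<^sup>2 = K * (real d + 2 * x)" using n0 by (simp add: x_def field_simps)
        moreover have "(C * (H * sqrt (real n * L)))\<^sup>2 = C\<^sup>2 * L * (real n * H\<^sup>2)"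
          using Lpos by (simp add: power_mult_distrib mult_ac)
        ultimately show ?thesis by (simp add: mult_ac)
      qed
      also have "\<dots> \<le> K * (3 * x\<^sup>2)" using xd K by (intro mult_left_mono) auto
      also have "\<dots> = (sqrt (3 * K) * x)\<^sup>2" using K by (simp add: power_mult_distrib)
      finally show "(C * (H * sqrt (real n * L)))\<^sup>2 \<le> (sqrt (3 * K) * x)\<^sup>2" .
    qed (use K xpos in auto)
    have gap: "s + r \<le> real n * \<epsilon> * (\<epsilon> * ?m\<^sup>2 / (2 * H)) * std_normal_density (T + M)"
    proof -
      have "2 * sqrt (3 * K) * G \<le> C * c" using C(5) c by (simp add: field_simps)
      then have "2 * sqrt (3 * K) * G * x \<le> C * c * x" using xpos by (intro mult_right_mono) auto
      moreover have "2 * G * (C * (H * sqrt (real n * L))) \<le> 2 * G * (sqrt (3 * K) * x)"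
        using G by (intro mult_left_mono HC) auto
      ultimately have "2 * G * (C * (H * sqrt (real n * L))) \<le> C * c * x" by (simp add: mult_ac)
      then have "C * (2 * H * (sqrt (real n * L) * G)) \<le> C * (c * x)" by (simp add: mult_ac)
      then have "2 * H * (sqrt (real n * L) * G) \<le> c * x" using C by simp
      moreover have "2 * H * (s + r) \<le> 2 * H * (sqrt (real n * L) * G)"
        using sr H by (intro mult_left_mono) auto
      ultimately have "s + r \<le> c * x / (2 * H)" using H by (simp add: field_simps)
      also have "\<dots> = real n * \<epsilon> * (\<epsilon> * ?m\<^sup>2 / (2 * H)) * c"
        by (simp add: x_def power2_eq_square)
      finally show ?thesis unfolding c_def .
    qed
    have n\<epsilon>1: "1 \<le> real n * \<epsilon>" using n\<epsilon> C by linarith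
    have tk: "real n * std_normal_tail t + s = real k" using t(1) n0 by simp
    have "\<P>(s in sample_law n d (mixture_density d \<epsilon> \<mu>). Psi2 \<alpha> n d s = 0)
        \<le> 4 / (real n * (\<epsilon> * ?m)\<^sup>2) + 4 / (real n * \<epsilon>) + 1 / K + exp (- 2 * r\<^sup>2 / real n)"
      by (rule Psi2_type_II_bound[OF n2 k(1) \<alpha> \<epsilon> m m_le n\<epsilon>1 K s0 r0 tk t(2) s_large gap[unfolded H_def]])
    also have "4 / (real n * (\<epsilon> * ?m)\<^sup>2) \<le> 4 / (32 / \<beta>)"
      using xC \<beta> xpos unfolding x_def[symmetric] by (intro divide_left_mono mult_pos_pos) auto
    also have "4 / (real n * \<epsilon>) \<le> 4 / (32 / \<beta>)"
      using n\<epsilon> C(3) \<beta> n0 \<epsilon> by (intro divide_left_mono mult_pos_pos) auto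
    also have "exp (- 2 * r\<^sup>2 / real n) = \<beta> / 2"
      using r2 \<beta> by (simp add: exp_minus)
    finally show "\<P>(s in sample_law n d (mixture_density d \<epsilon> \<mu>). Psi2 \<alpha> n d s = 0) \<le> \<beta>"
      by (simp add: K_def)
  qed
qed

theorem theorem5:
  fixes \<alpha> \<beta> M :: real
  assumes "0 < \<alpha>" "\<alpha> < 1" and "0 < \<beta>" "\<beta> < 1" and "M > 0"
  shows "(\<forall>n d :: nat. n \<ge> 2 \<longrightarrow> d \<ge> 1 \<longrightarrow> test_of_level \<alpha> n d (Psi2 \<alpha> n d)) \<and>
    (\<exists>C > 0. \<forall>(d::nat) (n::nat) (\<rho>::real).
       d \<ge> 1 \<longrightarrow> n \<ge> 3 \<longrightarrow> \<rho> > 0 \<longrightarrow>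
       \<rho> \<ge> C * (real d powr (1 / 4) / sqrt (real n)) * sqrt (ln (ln (real n))) \<longrightarrow>
       (\<forall>\<epsilon> \<mu>. 0 < \<epsilon> \<longrightarrow> \<epsilon> < 1 \<longrightarrow> \<mu> \<in> Rd d \<longrightarrow> norm_d d \<mu> \<le> M \<longrightarrow>
          \<epsilon> * norm_d d \<mu> \<ge> \<rho> \<longrightarrow> real n * \<epsilon> \<ge> C \<longrightarrow>
          \<P>(s in sample_law n d (mixture_density d \<epsilon> \<mu>). Psi2 \<alpha> n d s = 0) \<le> \<beta>))"
proof (rule conjI)
  show "\<forall>n d :: nat. n \<ge> 2 \<longrightarrow> d \<ge> 1 \<longrightarrow> test_of_level \<alpha> n d (Psi2 \<alpha> n d)"
    using Psi2_level assms by blast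
  from Psi2_power[OF assms(1-4)] obtain C where C: "C > 0" and power: "\<And>(d::nat) (n::nat) \<epsilon> \<mu>. d \<ge> 1 \<Longrightarrow> n \<ge> 3 \<Longrightarrow>
      0 < \<epsilon> \<Longrightarrow> \<epsilon> < 1 \<Longrightarrow> norm_d d \<mu> \<le> M \<Longrightarrow>
      C * (real d powr (1 / 4) / sqrt (real n)) * sqrt (ln (ln (real n))) \<le> \<epsilon> * norm_d d \<mu> \<Longrightarrow>
      C \<le> real n * \<epsilon> \<Longrightarrow>
      \<P>(s in sample_law n d (mixture_density d \<epsilon> \<mu>). Psi2 \<alpha> n d s = 0) \<le> \<beta>"
    by blast
  show "\<exists>C > 0. \<forall>(d::nat) (n::nat) (\<rho>::real).
       d \<ge> 1 \<longrightarrow> n \<ge> 3 \<longrightarrow> \<rho> > 0 \<longrightarrow>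
       \<rho> \<ge> C * (real d powr (1 / 4) / sqrt (real n)) * sqrt (ln (ln (real n))) \<longrightarrow>
       (\<forall>\<epsilon> \<mu>. 0 < \<epsilon> \<longrightarrow> \<epsilon> < 1 \<longrightarrow> \<mu> \<in> Rd d \<longrightarrow> norm_d d \<mu> \<le> M \<longrightarrow>
          \<epsilon> * norm_d d \<mu> \<ge> \<rho> \<longrightarrow> real n * \<epsilon> \<ge> C \<longrightarrow>
          \<P>(s in sample_law n d (mixture_density d \<epsilon> \<mu>). Psi2 \<alpha> n d s = 0) \<le> \<beta>)"
    using C by (intro exI[of _ C] conjI allI impI power) (assumption | erule (1) order_trans)+
qed

end
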